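(* Let $\mathcal G=(\mathcal V,\mathcal E,C)$ be a network with vector of inflows $\lambda\in\mathbb R_+^{\mathcal V\setminus\mathcal D}$ satisfying the connectivity assumption, with finite buffer capacities $B_e\in(0,+\infty)$, $e\in\mathcal E$, and let $f$ be a monotone distributed routing policy. Assume that $\max_{\mathcal U}\{\lambda_{\mathcal U}-C_{\mathcal U}\}>0$, the maximum being over all cuts $\mathcal U$. For $\rho^\circ\in\mathcal R=\prod_{e\in\mathcal E}[0,B_e)$, let $\{\rho(t):0\le t<\kappa(\rho^\circ)\}$ be the solution of $\dot\rho_e=f^{\mathrm{in}}_e(\rho)-f^{\mathrm{out}}_e(\rho^e)$, $e\in\mathcal E$, with $\rho(0)=\rho^\circ$. Then, for every $\rho^\circ\in\mathcal R$, $$\kappa(\rho^\circ)\le\min_{\mathcal U:\,\lambda_{\mathcal U}>C_{\mathcal U}}\frac{\sum_{e\in\mathcal E_{\mathcal U}^+}(B_e-\rho_e^\circ)}{\lambda_{\mathcal U}-C_{\mathcal U}},$$ and there exists a cut $\mathcal S$, possibly depending on $\rho^\circ$, such that $\lambda_{\mathcal S}>C_{\mathcal S}$ and $$\rho_e(t)<B_e\quad\forall e\in\mathcal E,\ 0\le t<\kappa(\rho^\circ),\qquad \lim_{t\to\kappa(\rho^\circ)}\rho_e(t)=B_e\quad\forall e\in\mathcal E^+_{\mathcal S}.$$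
   Context: Network. $\mathcal G=(\mathcal V,\mathcal E,C)$ is a finite directed multigraph (parallel links allowed, no self-loops) with link capacities $C_e\in(0,+\infty]$; link $e$ goes from $\sigma_e$ to $\tau_e$. For $v\in\mathcal V$: $\mathcal E_v^+=\{e\in\mathcal E:\sigma_e=v\}$, $\mathcal E_v^-=\{e\in\mathcal E:\tau_e=v\}$. For $\mathcal U\subseteq\mathcal V$: $\mathcal E^\pm_{\mathcal U}=\bigcup_{u\in\mathcal U}\mathcal E_u^\pm$, $\partial^+_{\mathcal U}=\{e\in\mathcal E:\sigma_e\in\mathcal U,\tau_e\notin\mathcal U\}$, $\partial^-_{\mathcal U}=\{e\in\mathcal E:\sigma_e\notin\mathcal U,\tau_e\in\mathcal U\}$. Destinations: $\mathcal D=\{v:\mathcal E_v^+=\emptyset\}$. Given $\lambda\in\mathbb R_+^{\mathcal V\setminus\mathcal D}$, origins: $\mathcal O=\{v:\lambda_v>0\}$. A cut is a nonempty $\mathcal U\subseteq\mathcal V\setminus\mathcal D$; $C_{\mathcal U}=\sum_{e\in\partial^+_{\mathcal U}}C_e$, $\lambda_{\mathcal U}=\sum_{v\in\mathcal U}\lambda_v$. Write $\mathcal E_{\mathcal D}^-=\bigcup_{d\in\mathcal D}\mathcal E_d^-$. Augmented network. Add a node $w$, source links $e_v=(w,v)$ for $v\in\mathcal O$ (set $\mathcal E_{\mathcal O}^-$) and sink links $e^d=(d,w)$ for $d\in\mathcal D$, all with infinite capacity. Connectivity assumption: $\mathcal D\neq\emptyset$ and the augmented network is strongly connected. Downstream/upstream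 links. For $e\in\mathcal E\setminus\mathcal E_{\mathcal D}^-$: $\mathcal E_e^+=\mathcal E_{\tau_e}^+$, $\mathcal E_e=\{e\}\cup\mathcal E_e^+$. For $e=e_v$, $v\in\mathcal O$: $\mathcal E_e=\mathcal E_e^+=\mathcal E_v^+$. For $e\in\mathcal E_{\mathcal D}^-$ with $\tau_e=d$: $\mathcal E_e^+=\{e^d\}$, and only the density of $e$ is relevant. For $e\in\mathcal E$, $\mathcal E_e^-$ consists of all $j\in\mathcal E$ with $\tau_j=\sigma_e$, together with $e_{\sigma_e}$ if $\sigma_e\in\mathcal O$. Local densities. $\mathcal R=\prod_{e\in\mathcal E}[0,B_e)$. $\rho^e=(\rho_k)_{k\in\mathcal E_e}$ (and $\rho^e=\rho_e$ if $e\in\mathcal E_{\mathcal D}^-$). For $e\in(\mathcal E\cup\mathcal E_{\mathcal O}^-)\setminus\mathcal E_{\mathcal D}^-$ let $\mathcal R^\bullet_e=\prod_{j\in\mathcal E_e}[0,B_j]\setminus\{(B_j)_{j\in\mathcal E_e}\}$; for $e\in\mathcal E_{\mathcal D}^-$ let $\mathcal R_e^\bullet=[0,B_e]$. Distributed routing policy. A family of locally Lipschitz maps $f^e=(f_{e\to j})_{j\in\mathcal E_e^+}:\mathcal R^\bullet_e\to\mathbb R_+^{\mathcal E_e^+}$, $e\in\mathcal E\cup\mathcal E_{\mathcal O}^-$, with $f^{\mathrm{out}}_e(\rho^e):=\sum_{j\in\mathcal E_e^+}f_{e\to j}(\rho^e)\le C_e$ (no constraint for source links), such that: $f^{\mathrm{out}}_{e_v}\equiv\lambda_v$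 for $v\in\mathcal O$; for $e\in\mathcal E$, $\rho^e\in\mathcal R^\bullet_e$: $\rho_e=0\Rightarrow f_e^{\mathrm{out}}(\rho^e)=0$ and $\rho_e=B_e\Rightarrow f_e^{\mathrm{out}}(\rho^e)=C_e$; for $e\in(\mathcal E\cup\mathcal E_{\mathcal O}^-)\setminus\mathcal E_{\mathcal D}^-$, $k\in\mathcal E_e^+$, $\rho^e\in\mathcal R^\bullet_e$: $\rho_k=B_k\Rightarrow f_{e\to k}(\rho^e)=0$. Put $f_e^{\mathrm{in}}(\rho)=\sum_{j\in\mathcal E_e^-}f_{j\to e}(\rho^j)$. The policy is monotone if for all $e\in\mathcal E\cup\mathcal E_{\mathcal O}^-$ and almost every $\rho^e\in\mathcal R_e^\bullet$: (a) $\partial f_{e\to j}/\partial\rho_k\ge0$ for all $j\in\mathcal E_e^+$ and all density-carrying links $k\in\mathcal E_e\setminus\{j\}$ (for $e\in\mathcal E_{\mathcal D}^-$, this means $k=e$); (b) $\partial f_e^{\mathrm{out}}/\partial\rho_k\le0$ for all $k\in\mathcal E_e^+\cap\mathcal E$. Solution. For $\rho^\circ\in\mathcal R$ the system has a unique solution with $\rho(0)=\rho^\circ$, defined up to $\kappa(\rho^\circ)=\sup\{t\ge0:\rho(t)\in\mathcal R\}$. *)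

theory Defs
  imports "HOL-Analysis.Analysis" "Graph_Theory.Digraph_Component"
begin

section \<open>Flow networks\<close>

text \<open>
  The multigraph is a \<^typ>\<open>('v, 'e) pre_digraph\<close>: \<^const>\<open>tail\<close> is the source
  and \<^const>\<open>head\<close> the target of a link. Link capacities are \<^typ>\<open>ereal\<close>s, so that
  infinite capacities are allowed. A vector indexed by a finite set is a function; wherever its
  domain matters, it is required to be extensional on that set.
\<close>

definition dests :: "('v, 'e) pre_digraph \<Rightarrow> 'v set" where
  "dests G = {v \<in> verts G. out_arcs G v = {}}"

definition origins :: "('v, 'e) pre_digraph \<Rightarrow> ('v \<Rightarrow> real) \<Rightarrow> 'v set" where
  "origins G lam = {v \<in> verts G - dests G. 0 < lam v}"

definition dest_links :: "('v, 'e) pre_digraph \<Rightarrow> 'e set" where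
  "dest_links G = (\<Union>d\<in>dests G. in_arcs G d)"

definition out_links :: "('v, 'e) pre_digraph \<Rightarrow> 'v set \<Rightarrow> 'e set" where
  "out_links G U = (\<Union>u\<in>U. out_arcs G u)"

definition out_boundary :: "('v, 'e) pre_digraph \<Rightarrow> 'v set \<Rightarrow> 'e set" where
  "out_boundary G U = {e \<in> arcs G. tail G e \<in> U \<and> head G e \<notin> U}"

definition cuts :: "('v, 'e) pre_digraph \<Rightarrow> 'v set set" where
  "cuts G = {U. U \<noteq> {} \<and> U \<subseteq> verts G - dests G}"

definition cut_capacity :: "('v, 'e) pre_digraph \<Rightarrow> ('e \<Rightarrow> ereal) \<Rightarrow> 'v set \<Rightarrow> ereal" where
  "cut_capacity G C U = (\<Sum>e\<in>out_boundary G U. C e)"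

definition cut_inflow :: "('v \<Rightarrow> real) \<Rightarrow> 'v set \<Rightarrow> real" where
  "cut_inflow lam U = (\<Sum>v\<in>U. lam v)"

definition flow_network ::
    "('v, 'e) pre_digraph \<Rightarrow> ('e \<Rightarrow> ereal) \<Rightarrow> ('v \<Rightarrow> real) \<Rightarrow> bool" where
  "flow_network G C lam \<longleftrightarrow>
     fin_digraph G \<and> loopfree_digraph G \<and>
     (\<forall>e\<in>arcs G. 0 < C e) \<and> (\<forall>v\<in>verts G - dests G. 0 \<le> lam v)"


section \<open>The augmented network\<close>

datatype ('v, 'e) alink = Link 'e | Source 'v | Sink 'v

text \<open>The additional node is \<^const>\<open>None\<close>.\<close>

definition augmented ::
    "('v, 'e) pre_digraph \<Rightarrow> ('v \<Rightarrow> real) \<Rightarrow> ('v option, ('v, 'e) alink) pre_digraph" where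
  "augmented G lam =
     \<lparr> verts = insert None (Some ` verts G),
       arcs = Link ` arcs G \<union> Source ` origins G lam \<union> Sink ` dests G,
       tail = (\<lambda>a. case a of Link e \<Rightarrow> Some (tail G e) | Source v \<Rightarrow> None | Sink d \<Rightarrow> Some d),
       head = (\<lambda>a. case a of Link e \<Rightarrow> Some (head G e) | Source v \<Rightarrow> Some v | Sink d \<Rightarrow> None) \<rparr>"

definition connectivity :: "('v, 'e) pre_digraph \<Rightarrow> ('v \<Rightarrow> real) \<Rightarrow> bool" where
  "connectivity G lam \<longleftrightarrow> dests G \<noteq> {} \<and> strongly_connected (augmented G lam)"

definition policy_links :: "('v, 'e) pre_digraph \<Rightarrow> ('v \<Rightarrow> real) \<Rightarrow> ('v, 'e) alink set" where
  "policy_links G lam = Link ` arcs G \<union> Source ` origins G lam"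

fun downstream :: "('v, 'e) pre_digraph \<Rightarrow> ('v, 'e) alink \<Rightarrow> ('v, 'e) alink set" where
  "downstream G (Link e) =
     (if e \<in> dest_links G then {Sink (head G e)} else Link ` out_arcs G (head G e))"
| "downstream G (Source v) = Link ` out_arcs G v"
| "downstream G (Sink d) = {}"

text \<open>
  The density-carrying links on which the policy of a link depends. For a link that enters a
  destination this is only the link itself, because a destination has no outgoing link.
\<close>

fun local_links :: "('v, 'e) pre_digraph \<Rightarrow> ('v, 'e) alink \<Rightarrow> 'e set" where
  "local_links G (Link e) = insert e (out_arcs G (head G e))"
| "local_links G (Source v) = out_arcs G v"
| "local_links G (Sink d) = {}"

definition upstream ::
    "('v, 'e) pre_digraph \<Rightarrow> ('v \<Rightarrow> real) \<Rightarrow> 'e \<Rightarrow> ('v, 'e) alink set" where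
  "upstream G lam e =
     Link ` in_arcs G (tail G e) \<union> Source ` ({tail G e} \<inter> origins G lam)"


section \<open>Monotone distributed routing policies\<close>

definition density_space :: "('v, 'e) pre_digraph \<Rightarrow> ('e \<Rightarrow> real) \<Rightarrow> ('e \<Rightarrow> real) set" where
  "density_space G B = (\<Pi>\<^sub>E e\<in>arcs G. {0..<B e})"

definition local_space ::
    "('v, 'e) pre_digraph \<Rightarrow> ('e \<Rightarrow> real) \<Rightarrow> ('v, 'e) alink \<Rightarrow> ('e \<Rightarrow> real) set" where
  "local_space G B a =
     (if a \<in> Link ` dest_links G then \<Pi>\<^sub>E k\<in>local_links G a. {0..B k}
      else (\<Pi>\<^sub>E k\<in>local_links G a. {0..B k}) - {restrict B (local_links G a)})"

text \<open>
  Local Lipschitz continuity, on \<open>X\<close>, of a map from \<open>K\<close>-indexed to \<open>J\<close>-indexed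
  vectors, for the Euclidean norms; the index sets \<open>K\<close> and \<open>J\<close> are finite.
\<close>

definition locally_lipschitz_on ::
    "'k set \<Rightarrow> 'j set \<Rightarrow> ('k \<Rightarrow> real) set \<Rightarrow> (('k \<Rightarrow> real) \<Rightarrow> 'j \<Rightarrow> real) \<Rightarrow> bool" where
  "locally_lipschitz_on K J X F \<longleftrightarrow>
     (\<forall>x\<in>X. \<exists>r>0. \<exists>L. \<forall>y\<in>X. \<forall>z\<in>X.
        L2_set (\<lambda>k. y k - x k) K < r \<longrightarrow> L2_set (\<lambda>k. z k - x k) K < r \<longrightarrow>
        L2_set (\<lambda>j. F y j - F z j) J \<le> L * L2_set (\<lambda>k. y k - z k) K)"

text \<open>
  A family of flow functions is a function \<open>f\<close> such that \<open>f a x j\<close> is the flow from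
  \<open>a\<close> to \<open>j\<close> when the local densities around \<open>a\<close> are \<open>x\<close>.
\<close>

type_synonym ('v, 'e) flow_family =
  "('v, 'e) alink \<Rightarrow> ('e \<Rightarrow> real) \<Rightarrow> ('v, 'e) alink \<Rightarrow> real"

definition f_out ::
    "('v, 'e) pre_digraph \<Rightarrow> ('v, 'e) flow_family \<Rightarrow> ('v, 'e) alink \<Rightarrow> ('e \<Rightarrow> real) \<Rightarrow> real" where
  "f_out G f a x = (\<Sum>j\<in>downstream G a. f a x j)"

definition f_in ::
    "('v, 'e) pre_digraph \<Rightarrow> ('v \<Rightarrow> real) \<Rightarrow> ('v, 'e) flow_family \<Rightarrow> 'e \<Rightarrow> ('e \<Rightarrow> real) \<Rightarrow> real" where
  "f_in G lam f e \<rho> = (\<Sum>a\<in>upstream G lam e. f a (restrict \<rho> (local_links G a)) (Link e))"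

definition routing_policy ::
    "('v, 'e) pre_digraph \<Rightarrow> ('e \<Rightarrow> ereal) \<Rightarrow> ('v \<Rightarrow> real) \<Rightarrow> ('e \<Rightarrow> real) \<Rightarrow>
     ('v, 'e) flow_family \<Rightarrow> bool" where
  "routing_policy G C lam B f \<longleftrightarrow>
     (\<forall>a\<in>policy_links G lam.
        locally_lipschitz_on (local_links G a) (downstream G a) (local_space G B a) (f a) \<and>
        (\<forall>x\<in>local_space G B a. \<forall>j\<in>downstream G a. 0 \<le> f a x j)) \<and>
     (\<forall>v\<in>origins G lam. \<forall>x\<in>local_space G B (Source v). f_out G f (Source v) x = lam v) \<and>
     (\<forall>e\<in>arcs G. \<forall>x\<in>local_space G B (Link e).
        ereal (f_out G f (Link e) x) \<le> C e \<and>
        (x e = 0 \<longrightarrow> f_out G f (Link e) x = 0) \<and>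
        (x e = B e \<longrightarrow> ereal (f_out G f (Link e) x) = C e)) \<and>
     (\<forall>a\<in>policy_links G lam - Link ` dest_links G. \<forall>k. Link k \<in> downstream G a \<longrightarrow>
        (\<forall>x\<in>local_space G B a. x k = B k \<longrightarrow> f a x (Link k) = 0))"

text \<open>
  Partial derivative in the coordinate \<open>k\<close>; the one-sided derivative that this yields on the
  boundary of the box is immaterial below, because the boundary is a null set.
\<close>

definition has_partial_derivative ::
    "(('e \<Rightarrow> real) \<Rightarrow> real) \<Rightarrow> ('e \<Rightarrow> real) \<Rightarrow> 'e \<Rightarrow> ('e \<Rightarrow> real) \<Rightarrow> real \<Rightarrow> bool" where
  "has_partial_derivative g B k x D \<longleftrightarrow>
     ((\<lambda>s. g (x(k := s))) has_real_derivative D) (at (x k) within {0..B k})"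

definition monotone_policy ::
    "('v, 'e) pre_digraph \<Rightarrow> ('v \<Rightarrow> real) \<Rightarrow> ('e \<Rightarrow> real) \<Rightarrow> ('v, 'e) flow_family \<Rightarrow> bool" where
  "monotone_policy G lam B f \<longleftrightarrow>
     (\<forall>a\<in>policy_links G lam.
        AE x in (\<Pi>\<^sub>M k\<in>local_links G a. lborel). x \<in> local_space G B a \<longrightarrow>
          (\<forall>j\<in>downstream G a. \<forall>k\<in>local_links G a. Link k \<noteq> j \<longrightarrow>
             (\<exists>D\<ge>0. has_partial_derivative (\<lambda>y. f a y j) B k x D)) \<and>
          (\<forall>k. Link k \<in> downstream G a \<longrightarrow>
             (\<exists>D\<le>0. has_partial_derivative (f_out G f a) B k x D)))"


section \<open>Solutions and their lifetime\<close>

definition solution_on ::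
    "('v, 'e) pre_digraph \<Rightarrow> ('v \<Rightarrow> real) \<Rightarrow> ('e \<Rightarrow> real) \<Rightarrow> ('v, 'e) flow_family \<Rightarrow>
     ('e \<Rightarrow> real) \<Rightarrow> real set \<Rightarrow> (real \<Rightarrow> 'e \<Rightarrow> real) \<Rightarrow> bool" where
  "solution_on G lam B f \<rho>0 T \<rho> \<longleftrightarrow>
     \<rho> 0 = \<rho>0 \<and>
     (\<forall>t\<in>T. \<rho> t \<in> density_space G B \<and>
        (\<forall>e\<in>arcs G. ((\<lambda>s. \<rho> s e) has_real_derivative
            f_in G lam f e (\<rho> t) - f_out G f (Link e) (restrict (\<rho> t) (local_links G (Link e))))
          (at t within T)))"

text \<open>
  The supremum of the times up to which the (unique) solution starting in \<open>\<rho>0\<close> exists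
  and stays in \<^const>\<open>density_space\<close>. The time \<open>0\<close> always belongs to the set
  when \<open>\<rho>0\<close> is in \<^const>\<open>density_space\<close>.
\<close>

definition lifetime ::
    "('v, 'e) pre_digraph \<Rightarrow> ('v \<Rightarrow> real) \<Rightarrow> ('e \<Rightarrow> real) \<Rightarrow> ('v, 'e) flow_family \<Rightarrow>
     ('e \<Rightarrow> real) \<Rightarrow> ereal" where
  "lifetime G lam B f \<rho>0 = Sup {ereal t | t. 0 \<le> t \<and> (\<exists>\<rho>. solution_on G lam B f \<rho>0 {0..t} \<rho>)}"

end

theory Submission
  imports Defs
begin

text \<open>
  Two facts carry the proof. The first is conservation of mass: summed over the links that start in a
  cut \<open>U\<close>, the densities grow at least at rate \<open>\<lambda>\<^sub>U - C\<^sub>U\<close>, because a link gives off at most its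
  capacity and the links that enter \<open>U\<close> only add mass (\<open>cut_balance\<close>). As the total buffer is
  bounded, this bounds the lifetime (\<open>solution_time_bound\<close>), so the lifetime \<open>\<kappa>\<close> is finite.

  The second is a barrier argument at time \<open>\<kappa>\<close>. Each density, corrected by a linear term, is
  nondecreasing in time, so \<open>\<rho>(t)\<close> has a limit \<open>x\<close> as \<open>t \<rightarrow> \<kappa>\<close> (\<open>solution_limit\<close>). If no
  link were full at \<open>x\<close>, the solution could be continued beyond \<open>\<kappa>\<close> (\<open>solution_extends\<close>, from local
  existence); hence the set \<open>F\<close> of links that are full at \<open>x\<close> is nonempty. Let \<open>S\<close> consist of the
  nodes, other than destinations, all of whose outgoing links are full. The space left,
  \<open>y(t) = \<Sum>\<^bsub>e\<in>F\<^esub> (B\<^sub>e - \<rho>\<^sub>e(t))\<close>, is positive before \<open>\<kappa>\<close> and tends to \<open>0\<close>.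

  Three kinds of flow can be estimated by a multiple of \<open>y\<close> near \<open>x\<close>, all for the same
  reason: the local densities of the link concerned stay in the set where its policy is locally
  Lipschitz, and the policy takes a known value as soon as one coordinate is moved to its buffer
  capacity.
    \<^item> The inflow into a full link that does not start in \<open>S\<close> vanishes when that link is full, and
      some link next to it has space left.
    \<^item> The outflow of a link that is not full and enters \<open>S\<close> vanishes when the links ahead are full.
    \<^item> The outflow of a link that leaves \<open>S\<close> equals its capacity when it is full.
  A full link that enters \<open>S\<close> from outside may behave badly, since everything around its head is
  full; but it lies in \<open>F\<close> itself, and what it passes on cancels against what it loses. Altogether
  \<open>y' \<ge> - (\<lambda>\<^sub>S - C\<^sub>S) - M y\<close> for some constant \<open>M\<close>. If \<open>\<lambda>\<^sub>S \<le> C\<^sub>S\<close>, then \<open>y' \<ge> - M y\<close> and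
  \<open>y\<close> could not reach \<open>0\<close> in finite time (\<open>exponential_barrier\<close>). Therefore \<open>\<lambda>\<^sub>S > C\<^sub>S\<close>, which also
  shows that \<open>S\<close> is nonempty (\<open>saturated_cut\<close>).
\<close>

section \<open>Differential equations with Lipschitz right-hand side\<close>

text \<open>
  By the fundamental theorem of calculus \<open>u\<close> is an integral of \<open>g\<close>, and an integral of a continuous
  function is differentiable at the end point, too. This is what makes a solution that is continued
  by its limit differentiable at the time where it is continued.
\<close>

lemma has_real_derivative_at_right_end:
  fixes u g :: "real \<Rightarrow> real"
  assumes "a < b" and u: "continuous_on {a..b} u" and g: "continuous_on {a..b} g"
    and deriv: "\<And>t. a < t \<Longrightarrow> t < b \<Longrightarrow> (u has_real_derivative g t) (at t)"
  shows "(u has_real_derivative g b) (at b within {a..b})"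
proof -
  have int: "integral {a..t} g = u t - u a" if "t \<in> {a..b}" for t
  proof (rule integral_unique, rule fundamental_theorem_of_calculus_interior)
    show "a \<le> t" using that by simp
    show "continuous_on {a..t} u" using u by (rule continuous_on_subset) (use that in auto)
    show "(u has_vector_derivative g x) (at x)" if "x \<in> {a<..<t}" for x
      using deriv[of x] that \<open>t \<in> {a..b}\<close> by (auto simp: has_real_derivative_iff_has_vector_derivative)
  qed
  have "((\<lambda>t. integral {a..t} g + u a) has_real_derivative g b + 0) (at b within {a..b})"
    by (intro DERIV_add integral_has_real_derivative[OF g] DERIV_const) (use assms(1) in auto)
  then have "((\<lambda>t. integral {a..t} g + u a) has_real_derivative g b) (at b within {a..b})" by simp
  then show ?thesis
    by (rule has_field_derivative_transform_within[OF _ zero_less_one]) (use assms(1) int in auto)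
qed

lemma has_real_derivative_within_Un:
  fixes u :: "real \<Rightarrow> real"
  assumes "closed X" "closed Y" "t \<in> X \<union> Y"
    and "t \<in> X \<Longrightarrow> (u has_real_derivative D) (at t within X)"
    and "t \<in> Y \<Longrightarrow> (u has_real_derivative D) (at t within Y)"
  shows "(u has_real_derivative D) (at t within X \<union> Y)"
proof -
  have *: "(u has_real_derivative D) (at t within Z)"
    if "closed Z" "t \<in> Z \<Longrightarrow> (u has_real_derivative D) (at t within Z)" for Z
  proof (cases "t \<in> Z")
    case False
    then have "at t within Z = bot" using that(1) by (simp add: at_within_eq_bot_iff)
    then show ?thesis by (simp add: has_field_derivative_iff)
  qed (use that in auto)
  have "(u has_real_derivative D) (at t within X)" "(u has_real_derivative D) (at t within Y)"
    by (rule *[OF assms(1,4)], assumption, rule *[OF assms(2,5)], assumption)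
  then show ?thesis
    unfolding has_field_derivative_iff unfolding at_within_union by (rule filterlim_sup)
qed

text \<open>
  Since \<open>y(t) exp (M t)\<close> is nondecreasing, a positive \<open>y\<close> that decays at most exponentially cannot
  reach \<open>0\<close> in finite time.
\<close>

lemma exponential_barrier:
  fixes y y' :: "real \<Rightarrow> real"
  assumes "a < b"
    and deriv: "\<And>t. a \<le> t \<Longrightarrow> t < b \<Longrightarrow> (y has_real_derivative y' t) (at t)"
    and bound: "\<And>t. a \<le> t \<Longrightarrow> t < b \<Longrightarrow> - M * y t \<le> y' t"
    and "0 < y a"
  shows "\<not> (y \<longlongrightarrow> 0) (at_left b)"
proof
  assume lim: "(y \<longlongrightarrow> 0) (at_left b)"
  have le: "y a * exp (M * a) \<le> y t * exp (M * t)" if "t \<in> {a<..<b}" for t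
  proof (rule DERIV_nonneg_imp_nondecreasing[where f = "\<lambda>t. y t * exp (M * t)"])
    show "a \<le> t" using that by simp
    fix x assume x: "a \<le> x" "x \<le> t"
    then have "((\<lambda>t. y t * exp (M * t)) has_real_derivative (y' x + M * y x) * exp (M * x)) (at x)"
      using that by (auto intro!: derivative_eq_intros deriv simp: algebra_simps)
    moreover have "0 \<le> (y' x + M * y x) * exp (M * x)" using bound[of x] x that by auto
    ultimately show "\<exists>z. ((\<lambda>t. y t * exp (M * t)) has_real_derivative z) (at x) \<and> 0 \<le> z" by blast
  qed
  have "((\<lambda>t. y t * exp (M * t)) \<longlongrightarrow> 0 * exp (M * b)) (at_left b)"
    by (intro tendsto_intros lim)
  moreover have "\<forall>\<^sub>F t in at_left b. y a * exp (M * a) \<le> y t * exp (M * t)"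
    using eventually_at_left_real[OF \<open>a < b\<close>] by eventually_elim (rule le)
  ultimately have "y a * exp (M * a) \<le> 0 * exp (M * b)"
    by (intro tendsto_lowerbound[of _ _ "at_left b"]) auto
  with \<open>0 < y a\<close> show False by (simp add: mult_le_0_iff not_le[symmetric])
qed

text \<open>
  A vector indexed by the finite set \<open>A\<close> is a function on a type without topology, so continuity is
  expressed coordinate by coordinate.
\<close>

lemma tendsto_lipschitz:
  fixes h :: "('e \<Rightarrow> real) \<Rightarrow> real"
  assumes lip: "\<forall>\<^sub>F s in F. \<bar>h (y s) - h x\<bar> \<le> L * (\<Sum>k\<in>A. \<bar>y s k - x k\<bar>)"
    and lim: "\<And>k. k \<in> A \<Longrightarrow> ((\<lambda>s. y s k) \<longlongrightarrow> x k) F"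
  shows "((\<lambda>s. h (y s)) \<longlongrightarrow> h x) F"
proof -
  have "((\<lambda>s. L * (\<Sum>k\<in>A. \<bar>y s k - x k\<bar>)) \<longlongrightarrow> L * (\<Sum>k\<in>A. \<bar>x k - x k\<bar>)) F"
    by (intro tendsto_intros lim)
  then have "((\<lambda>s. L * (\<Sum>k\<in>A. \<bar>y s k - x k\<bar>)) \<longlongrightarrow> 0) F" by simp
  then have "((\<lambda>s. h (y s) - h x) \<longlongrightarrow> 0) F"
    by (rule Lim_null_comparison[rotated]) (use lip in \<open>simp add: real_norm_def\<close>)
  then show ?thesis by (rule LIM_zero_cancel)
qed

lemma continuous_on_lipschitz:
  fixes h :: "('e \<Rightarrow> real) \<Rightarrow> real"
  assumes lip: "\<And>y z. \<bar>h y - h z\<bar> \<le> L * (\<Sum>k\<in>A. \<bar>y k - z k\<bar>)"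
    and cont: "\<And>k. k \<in> A \<Longrightarrow> continuous_on T (\<lambda>s. y s k)"
  shows "continuous_on T (\<lambda>s. h (y s))"
  unfolding continuous_on_def
proof
  fix t assume "t \<in> T"
  show "((\<lambda>s. h (y s)) \<longlongrightarrow> h (y t)) (at t within T)"
    by (rule tendsto_lipschitz[where L = L and A = A])
       (use cont \<open>t \<in> T\<close> lip in \<open>auto simp: continuous_on_def\<close>)
qed

text \<open>
  Picard iteration: on an interval so short that the integral operator halves distances, the
  iterates form a geometric series and converge uniformly to a solution of the integral equation.
\<close>

lemma lipschitz_ode_exists:
  fixes h :: "('e \<Rightarrow> real) \<Rightarrow> 'e \<Rightarrow> real"
  assumes A: "finite A" and L: "0 \<le> L"
    and lip: "\<And>y z e. e \<in> A \<Longrightarrow> \<bar>h y e - h z e\<bar> \<le> L * (\<Sum>k\<in>A. \<bar>y k - z k\<bar>)"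
  obtains \<epsilon> q where "0 < \<epsilon>" "\<And>e. q 0 e = x e"
    "\<And>t e. t \<in> {0..\<epsilon>} \<Longrightarrow> e \<in> A \<Longrightarrow>
       ((\<lambda>s. q s e) has_real_derivative h (q t) e) (at t within {0..\<epsilon>})"
proof -
  define c where "c = L * card A"
  \<comment> \<open>This choice makes \<open>c * \<epsilon> \<le> 1 / 2\<close>, the contraction factor of the iteration.\<close>
  define \<epsilon> where "\<epsilon> = 1 / (2 * (c + 1))"
  have c: "0 \<le> c" using L by (simp add: c_def)
  then have \<epsilon>: "0 < \<epsilon>" "c * \<epsilon> \<le> 1 / 2" by (auto simp: \<epsilon>_def field_simps)
  have lip_unif: "\<bar>h y e - h z e\<bar> \<le> c * r"
    if "e \<in> A" "\<And>k. k \<in> A \<Longrightarrow> \<bar>y k - z k\<bar> \<le> r" for y z e r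
  proof -
    have "\<bar>h y e - h z e\<bar> \<le> L * (\<Sum>k\<in>A. \<bar>y k - z k\<bar>)" using that by (intro lip)
    also have "\<dots> \<le> L * (\<Sum>k\<in>A. r)" by (intro mult_left_mono sum_mono L that)
    finally show ?thesis by (simp add: c_def algebra_simps)
  qed
  define p where "p = rec_nat (\<lambda>t::real. x)
    (\<lambda>n q t e. x e + integral {0..t} (\<lambda>s. h (q s) e))"
  have p_0: "p 0 = (\<lambda>t. x)" 
    and p_Suc: "p (Suc n) t e = x e + integral {0..t} (\<lambda>s. h (p n s) e)" for n t e
    by (simp_all add: p_def)
  have p_cont: "e \<in> A \<Longrightarrow> continuous_on {0..\<epsilon>} (\<lambda>t. p n t e)" for n e
  proof (induction n arbitrary: e)
    case 0
    then show ?case by (simp add: p_0)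
  next
    case (Suc n)
    have "continuous_on {0..\<epsilon>} (\<lambda>s. h (p n s) e)"
      using Suc by (intro continuous_on_lipschitz[where h = "\<lambda>y. h y e" and A = A, OF lip]) auto
    then show ?case unfolding p_Suc
      by (intro continuous_intros indefinite_integral_continuous_1 integrable_continuous_real)
  qed
  have hp_cont: "continuous_on {0..\<epsilon>} (\<lambda>s. h (p n s) e)" if "e \<in> A" for n e
    using that by (intro continuous_on_lipschitz[where h = "\<lambda>y. h y e" and A = A, OF lip] p_cont) auto
  define K where "K = \<epsilon> * (\<Sum>k\<in>A. \<bar>h x k\<bar>)"
  have step: "e \<in> A \<Longrightarrow> t \<in> {0..\<epsilon>} \<Longrightarrow> \<bar>p (Suc n) t e - p n t e\<bar> \<le> K * (1 / 2) ^ n" for n t e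
  proof (induction n arbitrary: t e)
    case 0
    have "\<bar>h x e\<bar> \<le> (\<Sum>k\<in>A. \<bar>h x k\<bar>)" using 0 A by (intro member_le_sum) auto
    then have "t * \<bar>h x e\<bar> \<le> \<epsilon> * (\<Sum>k\<in>A. \<bar>h x k\<bar>)" using 0 by (intro mult_mono) auto
    then show ?case using 0 by (simp add: p_Suc p_0 K_def abs_mult)
  next
    case (Suc n)
    have sub: "{0..t} \<subseteq> {0..\<epsilon>}" using Suc.prems by auto
    have cont: "continuous_on {0..t} (\<lambda>s. h (p m s) e)" for m
      using hp_cont[OF Suc.prems(1)] sub by (rule continuous_on_subset)
    have K: "0 \<le> K" using \<epsilon> by (simp add: K_def sum_nonneg)
    have "\<bar>p (Suc (Suc n)) t e - p (Suc n) t e\<bar>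
        = \<bar>integral {0..t} (\<lambda>s. h (p (Suc n) s) e - h (p n s) e)\<bar>"
      unfolding p_Suc[of "Suc n"] p_Suc[of n t]
      by (subst integral_diff) (auto intro!: integrable_continuous_real cont)
    also have "\<dots> \<le> (c * (K * (1 / 2) ^ n)) * (t - 0)"
      unfolding real_norm_def[symmetric]
    proof (rule integral_bound)
      show "0 \<le> t" using Suc.prems by simp
      show "continuous_on {0..t} (\<lambda>s. h (p (Suc n) s) e - h (p n s) e)"
        by (intro continuous_intros cont)
      show "norm (h (p (Suc n) s) e - h (p n s) e) \<le> c * (K * (1 / 2) ^ n)" if "s \<in> {0..t}" for s
        unfolding real_norm_def using that sub by (intro lip_unif Suc) auto
    qed
    also have "\<dots> = (c * t) * (K * (1 / 2) ^ n)" by simp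
    also have "\<dots> \<le> (1 / 2) * (K * (1 / 2) ^ n)"
    proof (rule mult_right_mono)
      have "c * t \<le> c * \<epsilon>" using Suc.prems c by (intro mult_left_mono) auto
      then show "c * t \<le> 1 / 2" using \<epsilon> by linarith
    qed (use K in auto)
    finally show ?case by simp
  qed
  define q where "q t e = x e + (\<Sum>i. p (Suc i) t e - p i t e)" for t e
  have lim: "uniform_limit {0..\<epsilon>} (\<lambda>n t. p n t e) (\<lambda>t. q t e) sequentially" if "e \<in> A" for e
  proof -
    have "uniform_limit {0..\<epsilon>} (\<lambda>n t. \<Sum>i<n. p (Suc i) t e - p i t e)
        (\<lambda>t. \<Sum>i. p (Suc i) t e - p i t e) sequentially"
    proof (rule Weierstrass_m_test_ev)
      show "\<forall>\<^sub>F n in sequentially. \<forall>t\<in>{0..\<epsilon>}. norm (p (Suc n) t e - p n t e) \<le> K * (1 / 2) ^ n"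
        using step[OF that] by (intro always_eventually) simp
      show "summable (\<lambda>n. K * (1 / 2) ^ n)" by (intro summable_mult summable_geometric) simp
    qed
    then have "uniform_limit {0..\<epsilon>} (\<lambda>n t. x e + (\<Sum>i<n. p (Suc i) t e - p i t e))
        (\<lambda>t. x e + (\<Sum>i. p (Suc i) t e - p i t e)) sequentially"
      by (intro uniform_limit_intros)
    moreover have "x e + (\<Sum>i<n. p (Suc i) t e - p i t e) = p n t e" for n t
      using sum_lessThan_telescope[of "\<lambda>i. p i t e" n] by (simp add: p_0)
    ultimately show ?thesis by (simp add: q_def)
  qed
  have hlim: "uniform_limit {0..\<epsilon>} (\<lambda>n t. h (p n t) e) (\<lambda>t. h (q t) e) sequentially" if "e \<in> A" for e
  proof (rule uniform_limitI)
    fix d :: real assume d: "0 < d"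
    have "\<forall>\<^sub>F n in sequentially. \<forall>k\<in>A. \<forall>t\<in>{0..\<epsilon>}. dist (p n t k) (q t k) < d / (c + 1)"
      using A c d by (intro eventually_ball_finite ballI uniform_limitD[OF lim]) auto
    then show "\<forall>\<^sub>F n in sequentially. \<forall>t\<in>{0..\<epsilon>}. dist (h (p n t) e) (h (q t) e) < d"
    proof eventually_elim
      case (elim n)
      show ?case
      proof
        fix t assume t: "t \<in> {0..\<epsilon>}"
        have "\<bar>h (p n t) e - h (q t) e\<bar> \<le> c * (d / (c + 1))"
          using elim t that by (intro lip_unif) (auto simp: dist_real_def intro: less_imp_le)
        also have "\<dots> < d" using c d by (simp add: field_simps)
        finally show "dist (h (p n t) e) (h (q t) e) < d" by (simp add: dist_real_def)
      qed
    qed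
  qed
  have integral_eq: "q t e = x e + integral {0..t} (\<lambda>s. h (q s) e)" if e: "e \<in> A" and t: "t \<in> {0..\<epsilon>}" for t e
  proof -
    have sub: "{0..t} \<subseteq> {0..\<epsilon>}" using t by auto
    obtain I J where I: "\<And>n. ((\<lambda>s. h (p n s) e) has_integral I n) {0..t}"
      and J: "((\<lambda>s. h (q s) e) has_integral J) {0..t}" and IJ: "I \<longlonglongrightarrow> J"
    proof (rule uniform_limit_integral)
      show "uniform_limit {0..t} (\<lambda>n s. h (p n s) e) (\<lambda>s. h (q s) e) sequentially"
        using hlim[OF e] sub by (rule uniform_limit_on_subset)
      show "continuous_on {0..t} (\<lambda>s. h (p n s) e)" for n
        using hp_cont[OF e] sub by (rule continuous_on_subset)
    qed auto
    have "(\<lambda>n. p (Suc n) t e) \<longlonglongrightarrow> q t e"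
      using tendsto_uniform_limitI[OF lim[OF e] t] by (rule LIMSEQ_Suc)
    moreover have "(\<lambda>n. p (Suc n) t e) \<longlonglongrightarrow> x e + J"
      unfolding p_Suc integral_unique[OF I] by (intro tendsto_intros IJ)
    ultimately show ?thesis using integral_unique[OF J] LIMSEQ_unique by metis
  qed
  have q_cont: "continuous_on {0..\<epsilon>} (\<lambda>t. q t e)" if "e \<in> A" for e
    by (rule uniform_limit_theorem[OF _ lim[OF that]]) (auto intro: always_eventually p_cont[OF that])
  show ?thesis
  proof
    show "0 < \<epsilon>" by fact
    have "p i 0 e = x e" for i e
      by (cases i) (simp_all add: p_0 p_Suc)
    then show "q 0 e = x e" for e by (simp add: q_def)
    fix t e assume t: "t \<in> {0..\<epsilon>}" and e: "e \<in> A"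
    have "((\<lambda>t. integral {0..t} (\<lambda>s. h (q s) e)) has_real_derivative h (q t) e) (at t within {0..\<epsilon>})"
      using q_cont e t
      by (intro integral_has_real_derivative
          continuous_on_lipschitz[where h = "\<lambda>y. h y e" and A = A, OF lip]) auto
    then have "((\<lambda>t. x e + integral {0..t} (\<lambda>s. h (q s) e)) has_real_derivative 0 + h (q t) e)
        (at t within {0..\<epsilon>})"
      by (intro DERIV_add DERIV_const)
    then show "((\<lambda>s. q s e) has_real_derivative h (q t) e) (at t within {0..\<epsilon>})"
      unfolding add_0_left
      by (rule has_field_derivative_transform_within[OF _ zero_less_one t]) (simp add: integral_eq[OF e])
  qed
qed

text \<open>
  On the last excursion below \<open>0\<close> the function could only increase.
\<close>

lemma nonneg_by_drift:
  fixes u D :: "real \<Rightarrow> real"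
  assumes deriv: "\<And>s. s \<in> {0..b} \<Longrightarrow> (u has_real_derivative D s) (at s within {0..b})"
    and "0 \<le> u 0" and up: "\<And>s. s \<in> {0..b} \<Longrightarrow> u s < 0 \<Longrightarrow> 0 \<le> D s" and t: "t \<in> {0..b}"
  shows "0 \<le> u t"
proof (rule ccontr)
  assume neg: "\<not> 0 \<le> u t"
  define S where "S = {s \<in> {0..t}. 0 \<le> u s}"
  have cont: "continuous_on {0..t} u"
    using DERIV_continuous_on[OF deriv] by (rule continuous_on_subset) (use t in auto)
  have "closed S" unfolding S_def by (intro continuous_on_closed_Collect_le cont continuous_intros)
  moreover have "bounded S" by (rule bounded_subset[of "{0..t}"]) (auto simp: S_def)
  ultimately have "compact S" by (simp add: compact_eq_bounded_closed)
  moreover have "0 \<in> S" using assms by (auto simp: S_def)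
  ultimately obtain s where s: "s \<in> S" and s_max: "\<And>r. r \<in> S \<Longrightarrow> r \<le> s"
    using compact_attains_sup[of S] by blast
  have s0: "0 \<le> s" "s \<le> t" "0 \<le> u s" using s by (auto simp: S_def)
  have "u s \<le> u t"
  proof (rule DERIV_nonneg_imp_increasing_open[OF s0(2)])
    show "continuous_on {s..t} u" using cont by (rule continuous_on_subset) (use s0 in auto)
    fix r assume r: "s < r" "r < t"
    then have "u r < 0" using s_max[of r] s0 by (force simp: S_def)
    then show "\<exists>y. (u has_real_derivative y) (at r) \<and> 0 \<le> y"
      using deriv[of r] up[of r] r s0 t by (auto simp: at_within_Icc_at)
  qed
  with s0 neg show False by simp
qed

section \<open>Flows in a buffered network\<close>

locale buffered_network =
  fixes G :: "('v, 'e) pre_digraph"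
    and C :: "'e \<Rightarrow> ereal"
    and lam :: "'v \<Rightarrow> real"
    and B :: "'e \<Rightarrow> real"
    and f :: "('v, 'e) flow_family"
  assumes network: "flow_network G C lam"
    and B_pos: "\<And>e. e \<in> arcs G \<Longrightarrow> 0 < B e"
    and policy: "routing_policy G C lam B f"
begin

lemma finite_arcs [simp]: "finite (arcs G)"
  and finite_verts [simp]: "finite (verts G)"
  using network by (auto simp: flow_network_def fin_digraph.finite_arcs fin_digraph.finite_verts)

lemma tail_in_verts: "e \<in> arcs G \<Longrightarrow> tail G e \<in> verts G"
  and head_in_verts: "e \<in> arcs G \<Longrightarrow> head G e \<in> verts G"
  using network
  by (auto simp: flow_network_def loopfree_digraph_def wf_digraph.tail_in_verts wf_digraph.head_in_verts)

lemma tail_neq_head: "e \<in> arcs G \<Longrightarrow> tail G e \<noteq> head G e"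
  using network by (auto simp: flow_network_def loopfree_digraph.no_loops)

lemma dest_links_iff: "e \<in> dest_links G \<longleftrightarrow> e \<in> arcs G \<and> head G e \<in> dests G"
  by (auto simp: dest_links_def)

lemma tail_not_dest: "e \<in> arcs G \<Longrightarrow> tail G e \<in> verts G - dests G"
  by (auto simp: dests_def tail_in_verts)

lemma local_links_subset: "a \<in> policy_links G lam \<Longrightarrow> local_links G a \<subseteq> arcs G"
  by (auto simp: policy_links_def)

lemma local_links_nonempty: "a \<in> policy_links G lam \<Longrightarrow> local_links G a \<noteq> {}"
  by (auto simp: policy_links_def origins_def dests_def)

lemma policy_links_upstream: "a \<in> upstream G lam e \<Longrightarrow> a \<in> policy_links G lam"
  by (auto simp: upstream_def policy_links_def)

lemma upstream_not_dest:
  "e \<in> arcs G \<Longrightarrow> a \<in> upstream G lam e \<Longrightarrow> a \<notin> Link ` dest_links G"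
  using tail_not_dest by (force simp: upstream_def dest_links_iff)

lemma downstream_upstream:
  "e \<in> arcs G \<Longrightarrow> a \<in> upstream G lam e \<Longrightarrow> downstream G a = Link ` out_arcs G (tail G e)"
  using upstream_not_dest[of e a] by (auto simp: upstream_def image_iff split: if_splits)

lemma local_links_upstream: "a \<in> upstream G lam e \<Longrightarrow> out_arcs G (tail G e) \<subseteq> local_links G a"
  by (auto simp: upstream_def)

lemma finite_in_arcs [simp]: "finite (in_arcs G v)"
  and finite_out_arcs [simp]: "finite (out_arcs G v)"
  by (auto simp: in_arcs_def out_arcs_def)

lemma finite_upstream [simp]: "finite (upstream G lam e)"
  by (simp add: upstream_def)

lemma finite_policy_links: "finite (policy_links G lam)"
  by (auto simp: policy_links_def origins_def)

lemma finite_downstream [simp]: "finite (downstream G a)"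
  by (cases a) simp_all

definition loc :: "('v, 'e) alink \<Rightarrow> ('e \<Rightarrow> real) \<Rightarrow> 'e \<Rightarrow> real" where
  "loc a y = restrict y (local_links G a)"

definition outflow :: "('e \<Rightarrow> real) \<Rightarrow> 'e \<Rightarrow> real" where
  "outflow y e = f_out G f (Link e) (loc (Link e) y)"

definition inflow :: "('e \<Rightarrow> real) \<Rightarrow> 'e \<Rightarrow> real" where
  "inflow y e = (\<Sum>a\<in>upstream G lam e. f a (loc a y) (Link e))"

definition drift :: "('e \<Rightarrow> real) \<Rightarrow> 'e \<Rightarrow> real" where
  "drift y e = inflow y e - outflow y e"

lemma solution_on_iff:
  "solution_on G lam B f \<rho>0 T \<rho> \<longleftrightarrow> \<rho> 0 = \<rho>0 \<and>
     (\<forall>t\<in>T. \<rho> t \<in> density_space G B \<and>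
       (\<forall>e\<in>arcs G. ((\<lambda>s. \<rho> s e) has_real_derivative drift (\<rho> t) e) (at t within T)))"
  by (simp add: solution_on_def drift_def outflow_def inflow_def loc_def f_in_def)

definition closed_box :: "('e \<Rightarrow> real) set" where
  "closed_box = {y. \<forall>e\<in>arcs G. 0 \<le> y e \<and> y e \<le> B e}"

lemma density_space_closed_box: "y \<in> density_space G B \<Longrightarrow> y \<in> closed_box"
  by (force simp: density_space_def closed_box_def PiE_iff)

text \<open>
  The only point of the box at which a policy may be undefined is the one where all links next to
  it are full. So a single link with space left suffices.
\<close>

lemma loc_in_space:
  assumes "a \<in> policy_links G lam" "y \<in> closed_box"
    and "a \<in> Link ` dest_links G \<or> (\<exists>k\<in>local_links G a. y k < B k)"
  shows "loc a y \<in> local_space G B a"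
proof -
  have box: "loc a y \<in> (\<Pi>\<^sub>E k\<in>local_links G a. {0..B k})"
    using assms(2) local_links_subset[OF assms(1)] by (auto simp: loc_def closed_box_def)
  have "loc a y \<noteq> restrict B (local_links G a)" if "k \<in> local_links G a" "y k < B k" for k
    using that by (auto simp: loc_def dest: fun_cong[of _ _ k])
  with box show ?thesis using assms(3) by (auto simp: local_space_def)
qed

lemma loc_in_space_density:
  assumes "a \<in> policy_links G lam" "y \<in> density_space G B"
  shows "loc a y \<in> local_space G B a"
proof (rule loc_in_space)
  show "a \<in> Link ` dest_links G \<or> (\<exists>k\<in>local_links G a. y k < B k)"
    using local_links_subset[OF assms(1)] local_links_nonempty[OF assms(1)] assms(2)
    by (fastforce simp: density_space_def PiE_iff)
qed (use assms density_space_closed_box in auto)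

lemma flow_nonneg:
  "a \<in> policy_links G lam \<Longrightarrow> loc a y \<in> local_space G B a \<Longrightarrow> j \<in> downstream G a \<Longrightarrow>
     0 \<le> f a (loc a y) j"
  using policy by (auto simp: routing_policy_def)

lemma flow_full:
  "a \<in> policy_links G lam \<Longrightarrow> a \<notin> Link ` dest_links G \<Longrightarrow> loc a y \<in> local_space G B a \<Longrightarrow>
     Link k \<in> downstream G a \<Longrightarrow> k \<in> local_links G a \<Longrightarrow> y k = B k \<Longrightarrow> f a (loc a y) (Link k) = 0"
  using policy by (auto simp: routing_policy_def loc_def)

lemma source_flow:
  "v \<in> origins G lam \<Longrightarrow> loc (Source v) y \<in> local_space G B (Source v) \<Longrightarrow>
     f_out G f (Source v) (loc (Source v) y) = lam v"
  using policy by (auto simp: routing_policy_def)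

lemma outflow_empty:
  "e \<in> arcs G \<Longrightarrow> loc (Link e) y \<in> local_space G B (Link e) \<Longrightarrow> y e = 0 \<Longrightarrow> outflow y e = 0"
  using policy by (auto simp: routing_policy_def loc_def outflow_def)

lemma outflow_nonneg:
  "e \<in> arcs G \<Longrightarrow> loc (Link e) y \<in> local_space G B (Link e) \<Longrightarrow> 0 \<le> outflow y e"
  unfolding outflow_def f_out_def by (intro sum_nonneg flow_nonneg) (auto simp: policy_links_def)

lemma inflow_nonneg:
  assumes "e \<in> arcs G" "\<And>a. a \<in> upstream G lam e \<Longrightarrow> loc a y \<in> local_space G B a"
  shows "0 \<le> inflow y e"
  unfolding inflow_def
  by (intro sum_nonneg flow_nonneg assms policy_links_upstream)
     (use assms downstream_upstream in auto)

definition cap :: "'e \<Rightarrow> real" where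
  "cap e = real_of_ereal (C e)"

text \<open>
  By the policy axioms the outflow of a full link, a real number, equals its capacity; and there is
  an admissible local density at which the link is full, because the links ahead of it, which are
  different from it in the absence of self-loops, may be empty.
\<close>

lemma capacity_finite:
  assumes e: "e \<in> arcs G"
  shows "C e = ereal (cap e)"
proof -
  define y where "y k = (if k = e then B e else 0)" for k
  have a: "Link e \<in> policy_links G lam" using e by (auto simp: policy_links_def)
  have "loc (Link e) y \<in> local_space G B (Link e)"
  proof (rule loc_in_space[OF a])
    show "y \<in> closed_box" using B_pos by (auto simp: closed_box_def y_def less_imp_le)
    show "Link e \<in> Link ` dest_links G \<or> (\<exists>k\<in>local_links G (Link e). y k < B k)"
    proof (cases "head G e \<in> dests G")
      case False
      then obtain k where "k \<in> out_arcs G (head G e)"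
        using head_in_verts[OF e] unfolding dests_def by blast
      moreover from this have "k \<noteq> e" using tail_neq_head[OF e] by auto
      ultimately show ?thesis using B_pos by (auto simp: y_def)
    qed (use e in \<open>auto simp: dest_links_iff\<close>)
  qed
  then have "ereal (f_out G f (Link e) (loc (Link e) y)) = C e"
    using policy e by (auto simp: routing_policy_def loc_def y_def)
  then show ?thesis unfolding cap_def by (metis real_of_ereal.simps(1))
qed

lemma outflow_le_cap:
  "e \<in> arcs G \<Longrightarrow> loc (Link e) y \<in> local_space G B (Link e) \<Longrightarrow> outflow y e \<le> cap e"
  using policy by (force simp: routing_policy_def outflow_def capacity_finite)

lemma outflow_full:
  "e \<in> arcs G \<Longrightarrow> loc (Link e) y \<in> local_space G B (Link e) \<Longrightarrow> y e = B e \<Longrightarrow> outflow y e = cap e"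
  using policy by (force simp: routing_policy_def outflow_def capacity_finite loc_def)

lemma out_boundary_subset: "out_boundary G U \<subseteq> arcs G"
  by (auto simp: out_boundary_def)

lemma cut_capacity_eq: "cut_capacity G C U = ereal (\<Sum>e\<in>out_boundary G U. cap e)"
proof -
  have "cut_capacity G C U = (\<Sum>e\<in>out_boundary G U. ereal (cap e))"
    unfolding cut_capacity_def by (intro sum.cong capacity_finite) (auto simp: out_boundary_def)
  then show ?thesis by simp
qed

lemma node_balance:
  assumes v: "v \<in> verts G - dests G" and y: "y \<in> density_space G B"
  shows "(\<Sum>e\<in>out_arcs G v. inflow y e) = lam v + (\<Sum>e\<in>in_arcs G v. outflow y e)"
proof -
  define Up where "Up = Link ` in_arcs G v \<union> Source ` ({v} \<inter> origins G lam)"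
  have Up: "upstream G lam e = Up" if "e \<in> out_arcs G v" for e
    using that by (auto simp: upstream_def Up_def)
  obtain e0 where e0: "e0 \<in> out_arcs G v" using v unfolding dests_def by blast
  have down: "downstream G a = Link ` out_arcs G v" if "a \<in> Up" for a
    using downstream_upstream[of e0 a] that e0 Up[OF e0] by auto
  have "(\<Sum>e\<in>out_arcs G v. inflow y e) = (\<Sum>e\<in>out_arcs G v. \<Sum>a\<in>Up. f a (loc a y) (Link e))"
    unfolding inflow_def by (rule sum.cong) (simp_all add: Up)
  also have "\<dots> = (\<Sum>a\<in>Up. f_out G f a (loc a y))"
    by (subst sum.swap) (auto intro!: sum.cong simp: f_out_def down sum.reindex inj_on_def)
  also have "\<dots> = (\<Sum>a\<in>Link ` in_arcs G v. f_out G f a (loc a y))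
      + (\<Sum>a\<in>Source ` ({v} \<inter> origins G lam). f_out G f a (loc a y))"
    unfolding Up_def by (intro sum.union_disjoint) auto
  also have "(\<Sum>a\<in>Link ` in_arcs G v. f_out G f a (loc a y)) = (\<Sum>e\<in>in_arcs G v. outflow y e)"
    by (simp add: sum.reindex inj_on_def outflow_def)
  also have "(\<Sum>a\<in>Source ` ({v} \<inter> origins G lam). f_out G f a (loc a y)) = lam v"
  proof (cases "v \<in> origins G lam")
    case True
    moreover have "loc (Source v) y \<in> local_space G B (Source v)"
      using y True by (intro loc_in_space_density) (auto simp: policy_links_def)
    ultimately show ?thesis by (simp add: source_flow)
  next
    case False
    have "0 \<le> lam v" using v network by (auto simp: flow_network_def)
    with False v show ?thesis by (auto simp: origins_def)
  qed
  finally show ?thesis by simp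
qed

text \<open>
  The flow along links inside \<open>U\<close> cancels. What remains is the exogenous inflow and the flow across
  the boundary.
\<close>

lemma cut_balance:
  assumes U: "U \<subseteq> verts G - dests G" and y: "y \<in> density_space G B"
  shows "(\<Sum>e\<in>out_links G U. drift y e) = cut_inflow lam U
    + (\<Sum>e\<in>{e \<in> arcs G. tail G e \<notin> U \<and> head G e \<in> U}. outflow y e)
    - (\<Sum>e\<in>out_boundary G U. outflow y e)"
proof -
  have fin: "finite U" using U finite_subset[OF _ finite_verts] by auto
  define H where "H = {e \<in> arcs G. head G e \<in> U}"
  define In where "In = {e \<in> arcs G. tail G e \<in> U \<and> head G e \<in> U}"
  define Ent where "Ent = {e \<in> arcs G. tail G e \<notin> U \<and> head G e \<in> U}"
  have finsets: "finite In" "finite Ent" "finite (out_boundary G U)"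
    by (auto simp: In_def Ent_def out_boundary_def)
  have "(\<Sum>e\<in>out_links G U. inflow y e) = (\<Sum>v\<in>U. \<Sum>e\<in>out_arcs G v. inflow y e)"
    unfolding out_links_def by (intro sum.UNION_disjoint) (use fin in auto)
  also have "\<dots> = (\<Sum>v\<in>U. lam v + (\<Sum>e\<in>in_arcs G v. outflow y e))"
    by (intro sum.cong node_balance y refl) (use U in auto)
  also have "\<dots> = cut_inflow lam U + (\<Sum>v\<in>U. \<Sum>e\<in>in_arcs G v. outflow y e)"
    by (simp add: sum.distrib cut_inflow_def)
  also have "(\<Sum>v\<in>U. \<Sum>e\<in>in_arcs G v. outflow y e) = (\<Sum>e\<in>(\<Union>v\<in>U. in_arcs G v). outflow y e)"
    by (intro sum.UNION_disjoint[symmetric]) (use fin in auto)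
  also have "(\<Union>v\<in>U. in_arcs G v) = In \<union> Ent" by (auto simp: In_def Ent_def)
  also have "(\<Sum>e\<in>In \<union> Ent. outflow y e) = (\<Sum>e\<in>In. outflow y e) + (\<Sum>e\<in>Ent. outflow y e)"
    by (intro sum.union_disjoint finsets) (auto simp: In_def Ent_def)
  finally have 1: "(\<Sum>e\<in>out_links G U. inflow y e)
    = cut_inflow lam U + ((\<Sum>e\<in>In. outflow y e) + (\<Sum>e\<in>Ent. outflow y e))" .
  have "out_links G U = In \<union> out_boundary G U"
    by (auto simp: In_def out_boundary_def out_links_def)
  then have 2: "(\<Sum>e\<in>out_links G U. outflow y e)
    = (\<Sum>e\<in>In. outflow y e) + (\<Sum>e\<in>out_boundary G U. outflow y e)"
    using finsets by (simp add: sum.union_disjoint In_def out_boundary_def disjoint_iff)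
  show ?thesis using 1 2 by (simp add: drift_def sum_subtractf Ent_def)
qed

lemma loc_Link_density:
  "e \<in> arcs G \<Longrightarrow> y \<in> density_space G B \<Longrightarrow> loc (Link e) y \<in> local_space G B (Link e)"
  by (rule loc_in_space_density) (auto simp: policy_links_def)

section \<open>The bound on the lifetime\<close>

text \<open>
  The mass on the links that start in \<open>U\<close> grows at least at the rate by which the exogenous inflow
  exceeds the capacity of the cut, and it stays below the total buffer capacity of these links.
\<close>

lemma solution_time_bound:
  assumes U: "U \<in> cuts G" and sol: "solution_on G lam B f \<rho>0 {0..t} \<rho>" and t: "0 \<le> t"
  shows "(cut_inflow lam U - (\<Sum>e\<in>out_boundary G U. cap e)) * t \<le> (\<Sum>e\<in>out_links G U. B e - \<rho>0 e)"
proof -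
  define c where "c = cut_inflow lam U - (\<Sum>e\<in>out_boundary G U. cap e)"
  have sub: "out_links G U \<subseteq> arcs G" by (auto simp: out_links_def)
  have deriv: "((\<lambda>s. (\<Sum>e\<in>out_links G U. \<rho> s e) - c * s) has_real_derivative
      (\<Sum>e\<in>out_links G U. drift (\<rho> s) e) - c) (at s within {0..t})" if "s \<in> {0..t}" for s
  proof (intro DERIV_diff DERIV_cmult_Id)
    have "((\<lambda>s. \<rho> s e) has_real_derivative drift (\<rho> s) e) (at s within {0..t})"
      if "e \<in> out_links G U" for e
      using sol sub that \<open>s \<in> {0..t}\<close> by (auto simp: solution_on_iff)
    then show "((\<lambda>s. \<Sum>e\<in>out_links G U. \<rho> s e) has_real_derivative
        (\<Sum>e\<in>out_links G U. drift (\<rho> s) e)) (at s within {0..t})"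
      by (rule DERIV_sum)
  qed
  have nonneg: "0 \<le> (\<Sum>e\<in>out_links G U. drift (\<rho> s) e) - c" if "s \<in> {0..t}" for s
  proof -
    have y: "\<rho> s \<in> density_space G B" using sol that by (auto simp: solution_on_iff)
    have "0 \<le> (\<Sum>e\<in>{e \<in> arcs G. tail G e \<notin> U \<and> head G e \<in> U}. outflow (\<rho> s) e)"
      by (intro sum_nonneg outflow_nonneg loc_Link_density y) auto
    moreover have "(\<Sum>e\<in>out_boundary G U. outflow (\<rho> s) e) \<le> (\<Sum>e\<in>out_boundary G U. cap e)"
      by (intro sum_mono outflow_le_cap loc_Link_density y) (auto simp: out_boundary_def)
    moreover have "U \<subseteq> verts G - dests G" using U by (auto simp: cuts_def)
    ultimately show ?thesis using cut_balance[OF _ y, of U] by (simp add: c_def)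
  qed
  have "(\<Sum>e\<in>out_links G U. \<rho> 0 e) - c * 0 \<le> (\<Sum>e\<in>out_links G U. \<rho> t e) - c * t"
  proof (rule DERIV_nonneg_imp_increasing_open[OF t,
        where f = "\<lambda>s. (\<Sum>e\<in>out_links G U. \<rho> s e) - c * s"])
    show "continuous_on {0..t} (\<lambda>s. (\<Sum>e\<in>out_links G U. \<rho> s e) - c * s)"
      by (rule DERIV_continuous_on[OF deriv])
    fix s assume "0 < s" "s < t"
    then show "\<exists>d. ((\<lambda>s. (\<Sum>e\<in>out_links G U. \<rho> s e) - c * s) has_real_derivative d) (at s) \<and> 0 \<le> d"
      using deriv[of s] nonneg[of s] by (auto simp: at_within_Icc_at)
  qed
  moreover have "(\<Sum>e\<in>out_links G U. \<rho> t e) \<le> (\<Sum>e\<in>out_links G U. B e)"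
    using sol t sub by (intro sum_mono) (force simp: solution_on_iff density_space_def PiE_iff)
  moreover have "\<rho> 0 = \<rho>0" using sol by (simp add: solution_on_iff)
  ultimately show ?thesis by (simp add: c_def sum_subtractf)
qed

section \<open>Lipschitz estimates for the flows\<close>

text \<open>
  One number \<open>m\<close> serves both as a Lipschitz constant and, through \<open>1 / m\<close>, as a radius. The
  estimates then hold for all large \<open>m\<close>, and finitely many of them have a common \<open>m\<close>.
\<close>

definition near :: "real \<Rightarrow> ('e \<Rightarrow> real) \<Rightarrow> ('e \<Rightarrow> real) \<Rightarrow> bool" where
  "near m x y \<longleftrightarrow> (\<forall>e\<in>arcs G. \<bar>y e - x e\<bar> < 1 / m)"

definition flow_lipschitz :: "real \<Rightarrow> ('e \<Rightarrow> real) \<Rightarrow> ('v, 'e) alink \<Rightarrow> bool" where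
  "flow_lipschitz m x a \<longleftrightarrow> (\<forall>y z j.
     loc a y \<in> local_space G B a \<longrightarrow> loc a z \<in> local_space G B a \<longrightarrow> near m x y \<longrightarrow> near m x z \<longrightarrow>
     j \<in> downstream G a \<longrightarrow>
     \<bar>f a (loc a y) j - f a (loc a z) j\<bar> \<le> m * (\<Sum>e\<in>arcs G. \<bar>y e - z e\<bar>))"

lemma flow_lipschitz_eventually:
  assumes a: "a \<in> policy_links G lam" and x: "loc a x \<in> local_space G B a"
  shows "\<forall>\<^sub>F m in at_top. flow_lipschitz m x a"
proof -
  let ?K = "local_links G a"
  have sub: "?K \<subseteq> arcs G" by (rule local_links_subset[OF a])
  define lip where "lip r L \<longleftrightarrow> (\<forall>y\<in>local_space G B a. \<forall>z\<in>local_space G B a.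
      L2_set (\<lambda>k. y k - loc a x k) ?K < r \<longrightarrow> L2_set (\<lambda>k. z k - loc a x k) ?K < r \<longrightarrow>
      L2_set (\<lambda>j. f a y j - f a z j) (downstream G a) \<le> L * L2_set (\<lambda>k. y k - z k) ?K)" for r L
  have "locally_lipschitz_on ?K (downstream G a) (local_space G B a) (f a)"
    using policy a by (auto simp: routing_policy_def)
  from bspec[OF this[unfolded locally_lipschitz_on_def] x]
  have "\<exists>r>0. \<exists>L. lip r L" by (simp only: lip_def)
  then obtain r L where r: "0 < r" and L: "lip r L" by blast
  have close: "L2_set (\<lambda>k. loc a y k - loc a x k) ?K < r"
    if m: "(real (card ?K) + 1) / r \<le> m" and y: "near m x y" for m y
  proof -
    have "0 < (real (card ?K) + 1) / r" using r by (intro divide_pos_pos) auto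
    then have m0: "0 < m" using m by linarith
    have "L2_set (\<lambda>k. loc a y k - loc a x k) ?K \<le> (\<Sum>k\<in>?K. \<bar>loc a y k - loc a x k\<bar>)"
      by (rule L2_set_le_sum_abs)
    also have "\<dots> \<le> (\<Sum>k\<in>?K. 1 / m)"
      using y sub by (intro sum_mono) (auto simp: near_def loc_def intro!: less_imp_le)
    also have "\<dots> = card ?K / m" by simp
    also have "\<dots> < r"
    proof -
      have "real (card ?K) < real (card ?K) + 1" by simp
      also have "\<dots> \<le> r * m" using m r by (simp add: field_simps)
      finally show ?thesis using m0 by (simp add: field_simps)
    qed
    finally show ?thesis .
  qed
  show ?thesis
    using eventually_ge_at_top[of "(real (card ?K) + 1) / r"] eventually_ge_at_top[of "\<bar>L\<bar>"]
  proof eventually_elim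
    case (elim m)
    show ?case unfolding flow_lipschitz_def
    proof (intro allI impI)
      fix y z j
      assume y: "loc a y \<in> local_space G B a" "near m x y"
        and z: "loc a z \<in> local_space G B a" "near m x z"
        and j: "j \<in> downstream G a"
      have "\<bar>f a (loc a y) j - f a (loc a z) j\<bar>
          \<le> L2_set (\<lambda>j. \<bar>f a (loc a y) j - f a (loc a z) j\<bar>) (downstream G a)"
        by (rule member_le_L2_set) (use j in auto)
      also have "\<dots> = L2_set (\<lambda>j. f a (loc a y) j - f a (loc a z) j) (downstream G a)"
        by (simp add: L2_set_def)
      also have "\<dots> \<le> L * L2_set (\<lambda>k. loc a y k - loc a z k) ?K"
        using y z elim by (intro L[unfolded lip_def, rule_format] close) auto
      also have "\<dots> \<le> m * (\<Sum>k\<in>?K. \<bar>loc a y k - loc a z k\<bar>)"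
        using elim by (intro mult_mono L2_set_le_sum_abs) auto
      also have "(\<Sum>k\<in>?K. \<bar>loc a y k - loc a z k\<bar>) = (\<Sum>k\<in>?K. \<bar>y k - z k\<bar>)"
        by (simp add: loc_def)
      also have "m * \<dots> \<le> m * (\<Sum>e\<in>arcs G. \<bar>y e - z e\<bar>)"
        using elim sub by (intro mult_left_mono sum_mono2) auto
      finally show "\<bar>f a (loc a y) j - f a (loc a z) j\<bar> \<le> m * (\<Sum>e\<in>arcs G. \<bar>y e - z e\<bar>)" .
    qed
  qed
qed

text \<open>
  The base point \<open>x\<close> need not lie in the density space: the estimate is available for every link
  whose local densities at \<open>x\<close> are admissible, in particular when \<open>x\<close> is a limit at which some
  links are full.
\<close>

lemma flows_lipschitz:
  "\<exists>m>0. \<forall>a\<in>policy_links G lam. loc a x \<in> local_space G B a \<longrightarrow> flow_lipschitz m x a"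
proof -
  have "\<forall>\<^sub>F m in at_top. 0 < (m::real) \<and>
      (\<forall>a\<in>{a \<in> policy_links G lam. loc a x \<in> local_space G B a}. flow_lipschitz m x a)"
    by (intro eventually_conj eventually_gt_at_top eventually_ball_finite ballI
        flow_lipschitz_eventually) (auto simp: finite_policy_links)
  then show ?thesis by (auto dest!: eventually_happens)
qed

lemma Link_policy [simp]: "e \<in> arcs G \<Longrightarrow> Link e \<in> policy_links G lam"
  by (auto simp: policy_links_def)

definition drift_lipschitz :: "real \<Rightarrow> ('e \<Rightarrow> real) \<Rightarrow> bool" where
  "drift_lipschitz m x \<longleftrightarrow> (\<forall>y z e. y \<in> density_space G B \<longrightarrow> z \<in> density_space G B \<longrightarrow>
     near m x y \<longrightarrow> near m x z \<longrightarrow> e \<in> arcs G \<longrightarrow>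
     \<bar>drift y e - drift z e\<bar> \<le> m * (\<Sum>k\<in>arcs G. \<bar>y k - z k\<bar>))"

lemma drift_locally_lipschitz:
  assumes x: "x \<in> density_space G B"
  shows "\<exists>M>0. drift_lipschitz M x"
proof -
  obtain m where m: "0 < m"
    and lip: "\<forall>a\<in>policy_links G lam. loc a x \<in> local_space G B a \<longrightarrow> flow_lipschitz m x a"
    using flows_lipschitz[of x] by blast
  define n where "n e = real (card (upstream G lam e) + card (downstream G (Link e :: ('v, 'e) alink)))" for e
  define N where "N = 1 + (\<Sum>e\<in>arcs G. n e)"
  have n: "0 \<le> n e" for e by (simp add: n_def)
  have N: "1 \<le> N" by (simp add: N_def n sum_nonneg)
  have nN: "n e \<le> N" if "e \<in> arcs G" for e
    using member_le_sum[of e "arcs G" n] that n by (simp add: N_def)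
  have "drift_lipschitz (m * N) x"
    unfolding drift_lipschitz_def
  proof (intro allI impI)
    fix y z e
    assume y: "y \<in> density_space G B" and z: "z \<in> density_space G B" and e: "e \<in> arcs G"
      and near_N: "near (m * N) x y" "near (m * N) x z"
    have "1 / (m * N) \<le> 1 / m" using m N by (simp add: field_simps)
    then have near_m: "near m x y" "near m x z"
      using near_N unfolding near_def by (auto intro: less_le_trans)
    define d where "d = (\<Sum>k\<in>arcs G. \<bar>y k - z k\<bar>)"
    have d: "0 \<le> d" by (simp add: d_def sum_nonneg)
    have flow: "\<bar>f a (loc a y) j - f a (loc a z) j\<bar> \<le> m * d"
      if "a \<in> policy_links G lam" "j \<in> downstream G a" for a j
    proof -
      have "flow_lipschitz m x a" using lip that(1) loc_in_space_density[OF that(1) x] by blast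
      with that near_m show ?thesis
        using loc_in_space_density[OF that(1) y] loc_in_space_density[OF that(1) z]
        unfolding flow_lipschitz_def d_def by blast
    qed
    have "\<bar>inflow y e - inflow z e\<bar> \<le> (\<Sum>a\<in>upstream G lam e. m * d)"
      unfolding inflow_def sum_subtractf[symmetric]
      by (intro order_trans[OF sum_abs] sum_mono flow policy_links_upstream)
         (use e downstream_upstream in auto)
    moreover have "\<bar>outflow y e - outflow z e\<bar> \<le> (\<Sum>j\<in>downstream G (Link e :: ('v, 'e) alink). m * d)"
      unfolding outflow_def f_out_def sum_subtractf[symmetric]
      by (intro order_trans[OF sum_abs] sum_mono flow) (use e in auto)
    ultimately have "\<bar>drift y e - drift z e\<bar> \<le> n e * (m * d)"
      by (simp add: drift_def n_def algebra_simps)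
    also have "\<dots> \<le> N * (m * d)" using nN[OF e] m d by (intro mult_right_mono) auto
    finally show "\<bar>drift y e - drift z e\<bar> \<le> m * N * (\<Sum>k\<in>arcs G. \<bar>y k - z k\<bar>)"
      by (simp add: d_def algebra_simps)
  qed
  then show ?thesis using m N by (intro exI[of _ "m * N"]) simp
qed

lemma drift_tendsto:
  assumes x: "x \<in> density_space G B" and "e \<in> arcs G"
    and lim: "\<And>k. k \<in> arcs G \<Longrightarrow> ((\<lambda>s. y s k) \<longlongrightarrow> x k) F"
    and y: "\<forall>\<^sub>F s in F. y s \<in> density_space G B"
  shows "((\<lambda>s. drift (y s) e) \<longlongrightarrow> drift x e) F"
proof -
  obtain M where M: "0 < M" "drift_lipschitz M x" using drift_locally_lipschitz[OF x] by blast
  have "\<forall>\<^sub>F s in F. \<forall>k\<in>arcs G. dist (y s k) (x k) < 1 / M"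
    using M(1) by (intro eventually_ball_finite ballI tendstoD[OF lim]) auto
  with y have "\<forall>\<^sub>F s in F. \<bar>drift (y s) e - drift x e\<bar> \<le> M * (\<Sum>k\<in>arcs G. \<bar>y s k - x k\<bar>)"
  proof eventually_elim
    case (elim s)
    then have "near M x (y s)" "near M x x" using M(1) by (auto simp: near_def dist_real_def)
    with elim x M(2) assms(2) show ?case unfolding drift_lipschitz_def by blast
  qed
  then show ?thesis by (rule tendsto_lipschitz[where h = "\<lambda>y. drift y e"]) (rule lim)
qed

lemma drift_nonneg_at_empty:
  "e \<in> arcs G \<Longrightarrow> y \<in> density_space G B \<Longrightarrow> y e = 0 \<Longrightarrow> 0 \<le> drift y e"
  using inflow_nonneg[of e y] outflow_empty[of e y] loc_in_space_density[OF policy_links_upstream]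
    loc_Link_density[of e y] by (simp add: drift_def)

section \<open>Local existence and continuation of solutions\<close>

text \<open>
  The vector field is only given on the density space. It is extended to all vectors by clamping
  each coordinate to a small interval around \<open>x\<close> inside its range, which makes it globally Lipschitz.
  The solution of the extended equation is one of the original equation as long as clamping does not
  change it: for a short time it stays close to \<open>x\<close> by continuity, and it cannot become negative
  because the drift of an empty link is nonnegative.
\<close>

lemma local_solution:
  assumes x: "x \<in> density_space G B"
  obtains \<epsilon> \<rho> where "0 < \<epsilon>" "solution_on G lam B f x {0..\<epsilon>} \<rho>"
proof -
  have x_box: "0 \<le> x e" "x e < B e" if "e \<in> arcs G" for e
    using x that by (auto simp: density_space_def PiE_iff)
  obtain M where M: "0 < M" "drift_lipschitz M x" using drift_locally_lipschitz[OF x] by blast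
  have "\<forall>\<^sub>F r in at_right 0. 0 < r \<and> r < 1 / M \<and> (\<forall>e\<in>arcs G. r < B e - x e)"
    using M(1) x_box
    by (intro eventually_conj eventually_ball_finite ballI eventually_at_right_real
        eventually_at_right_less order_tendstoD(2)[OF tendsto_ident_at]) auto
  then obtain r where r: "0 < r" "r < 1 / M" "\<And>e. e \<in> arcs G \<Longrightarrow> r < B e - x e"
    by (auto dest!: eventually_happens)
  define clamp where "clamp y = (\<lambda>e\<in>arcs G. max (max 0 (x e - r)) (min (x e + r) (y e)))" for y
  have clamp_in: "clamp y \<in> density_space G B" for y
    using r x_box B_pos by (fastforce simp: clamp_def density_space_def)
  have clamp_near: "near M x (clamp y)" for y
    unfolding near_def
  proof
    fix k assume k: "k \<in> arcs G"
    show "\<bar>clamp y k - x k\<bar> < 1 / M" using r x_box[OF k] k by (auto simp: clamp_def)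
  qed
  have clamp_lip: "\<bar>clamp y k - clamp z k\<bar> \<le> \<bar>y k - z k\<bar>" if "k \<in> arcs G" for y z k
    using that by (simp add: clamp_def max_def min_def)
  have "\<bar>drift (clamp y) e - drift (clamp z) e\<bar> \<le> M * (\<Sum>k\<in>arcs G. \<bar>y k - z k\<bar>)"
    if "e \<in> arcs G" for y z e
  proof -
    have "\<bar>drift (clamp y) e - drift (clamp z) e\<bar> \<le> M * (\<Sum>k\<in>arcs G. \<bar>clamp y k - clamp z k\<bar>)"
      using M(2) clamp_in clamp_near that unfolding drift_lipschitz_def by blast
    also have "\<dots> \<le> M * (\<Sum>k\<in>arcs G. \<bar>y k - z k\<bar>)"
      using M(1) by (intro mult_left_mono sum_mono clamp_lip) auto
    finally show ?thesis .
  qed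
  then obtain \<epsilon> q where \<epsilon>: "0 < \<epsilon>" and q0: "\<And>e. q 0 e = x e"
    and q: "\<And>t e. t \<in> {0..\<epsilon>} \<Longrightarrow> e \<in> arcs G \<Longrightarrow>
       ((\<lambda>s. q s e) has_real_derivative drift (clamp (q t)) e) (at t within {0..\<epsilon>})"
    using lipschitz_ode_exists[OF finite_arcs less_imp_le[OF M(1)], of "\<lambda>y. drift (clamp y)" x]
    by blast
  have lim: "((\<lambda>s. q s e) \<longlongrightarrow> x e) (at 0 within {0..\<epsilon>})" if "e \<in> arcs G" for e
    using DERIV_continuous[OF q[OF _ that, of 0]] \<epsilon> by (simp add: continuous_within q0)
  have "\<forall>\<^sub>F s in at 0 within {0..\<epsilon>}. \<forall>e\<in>arcs G. dist (q s e) (x e) < r"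
    using r by (intro eventually_ball_finite ballI tendstoD[OF lim]) auto
  then obtain d where d: "0 < d" "\<And>s e. s \<in> {0..\<epsilon>} \<Longrightarrow> s \<noteq> 0 \<Longrightarrow> dist s 0 < d \<Longrightarrow> e \<in> arcs G \<Longrightarrow>
      dist (q s e) (x e) < r"
    unfolding eventually_at by metis
  define \<delta> where "\<delta> = min \<epsilon> (d / 2)"
  have \<delta>: "0 < \<delta>" "\<delta> \<le> \<epsilon>" using \<epsilon> d(1) by (auto simp: \<delta>_def)
  have near: "\<bar>q s e - x e\<bar> < r" if "s \<in> {0..\<delta>}" "e \<in> arcs G" for s e
    using d(2)[of s e] d(1) that r(1) q0 by (cases "s = 0") (auto simp: \<delta>_def dist_real_def)
  have q': "((\<lambda>s. q s e) has_real_derivative drift (clamp (q t)) e) (at t within {0..\<delta>})"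
    if "t \<in> {0..\<delta>}" "e \<in> arcs G" for t e
    by (rule has_field_derivative_subset[OF q]) (use that \<delta> in auto)
  have nonneg: "0 \<le> q t e" if t: "t \<in> {0..\<delta>}" and e: "e \<in> arcs G" for t e
  proof (rule nonneg_by_drift[OF q'[OF _ e] _ _ t])
    show "0 \<le> q 0 e" using x_box[OF e] by (simp add: q0)
    fix s assume s: "s \<in> {0..\<delta>}" "q s e < 0"
    then have "clamp (q s) e = 0" using near[OF s(1) e] x_box[OF e] r(1) e by (auto simp: clamp_def)
    then show "0 \<le> drift (clamp (q s)) e" by (intro drift_nonneg_at_empty e clamp_in)
  qed
  have clamp_q: "clamp (q t) = restrict (q t) (arcs G)" if "t \<in> {0..\<delta>}" for t
  proof
    fix e show "clamp (q t) e = restrict (q t) (arcs G) e"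
      using nonneg[OF that, of e] near[OF that, of e] by (auto simp: clamp_def)
  qed
  have "solution_on G lam B f x {0..\<delta>} (\<lambda>t. restrict (q t) (arcs G))"
    unfolding solution_on_iff
  proof (intro conjI ballI)
    show "restrict (q 0) (arcs G) = x"
      using x by (auto simp: q0 density_space_def PiE_iff extensional_def fun_eq_iff)
    fix t assume t: "t \<in> {0..\<delta>}"
    show "restrict (q t) (arcs G) \<in> density_space G B" using clamp_in[of "q t"] clamp_q[OF t] by simp
    fix e assume e: "e \<in> arcs G"
    show "((\<lambda>s. restrict (q s) (arcs G) e) has_real_derivative drift (restrict (q t) (arcs G)) e)
        (at t within {0..\<delta>})"
      using q'[OF t e] e clamp_q[OF t] by simp
  qed
  with \<delta>(1) show ?thesis by (rule that)
qed

text \<open>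
  The continuation starts from the limit point. Both pieces are differentiable at time \<open>k\<close> from
  their side, the first one because its drift converges to the drift at the limit point.
\<close>

lemma solution_extends:
  assumes k: "0 < k" and sol: "solution_on G lam B f \<rho>0 {0..<k} \<rho>"
    and x: "x \<in> density_space G B"
    and lim: "\<And>e. e \<in> arcs G \<Longrightarrow> ((\<lambda>t. \<rho> t e) \<longlongrightarrow> x e) (at_left k)"
  shows "\<exists>t>k. \<exists>\<sigma>. solution_on G lam B f \<rho>0 {0..t} \<sigma>"
proof -
  obtain \<epsilon> q where \<epsilon>: "0 < \<epsilon>" and q: "solution_on G lam B f x {0..\<epsilon>} q"
    using local_solution[OF x] .
  define \<sigma> where "\<sigma> t = (if t < k then \<rho> t else q (t - k))" for t
  have \<sigma>_left: "t < k \<Longrightarrow> \<sigma> t = \<rho> t" and \<sigma>_right: "k \<le> t \<Longrightarrow> \<sigma> t = q (t - k)"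
    and \<sigma>_k: "\<sigma> k = x" for t
    using q by (auto simp: \<sigma>_def solution_on_iff)
  have \<sigma>_in: "\<sigma> t \<in> density_space G B" if "t \<in> {0..k + \<epsilon>}" for t
    using sol q that by (auto simp: \<sigma>_def solution_on_iff)
  have inner: "((\<lambda>s. \<sigma> s e) has_real_derivative drift (\<sigma> t) e) (at t within {0..k})"
    if "0 \<le> t" "t < k" "e \<in> arcs G" for t e
  proof -
    have "((\<lambda>s. \<rho> s e) has_real_derivative drift (\<rho> t) e) (at t within {0..<k})"
      using sol that by (auto simp: solution_on_iff)
    moreover have "at t within {0..<k} = at t within {0..k}"
      by (rule at_within_nhd[of _ "{..<k}"]) (use that in auto)
    ultimately have "((\<lambda>s. \<rho> s e) has_real_derivative drift (\<sigma> t) e) (at t within {0..k})"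
      using that by (simp add: \<sigma>_left)
    then show ?thesis
      by (rule has_field_derivative_transform_within[where d = "k - t"])
         (use that in \<open>auto simp: \<sigma>_left dist_real_def\<close>)
  qed
  have cont: "continuous_on {0..k} (\<lambda>s. \<sigma> s e)" if e: "e \<in> arcs G" for e
    unfolding continuous_on_eq_continuous_within
  proof
    fix t assume t: "t \<in> {0..k}"
    show "continuous (at t within {0..k}) (\<lambda>s. \<sigma> s e)"
    proof (cases "t = k")
      case True
      have "((\<lambda>s. \<sigma> s e) \<longlongrightarrow> x e) (at_left k)"
        using lim[OF e] by (rule Lim_transform_eventually) (auto simp: eventually_at_filter \<sigma>_left)
      moreover have "at k within {0..k} = at_left k" using k by (intro at_within_Icc_at_left)
      ultimately show ?thesis using True by (simp add: continuous_within \<sigma>_k)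
    qed (use DERIV_continuous[OF inner, of t e] t e in auto)
  qed
  have drift_cont: "continuous_on {0..k} (\<lambda>s. drift (\<sigma> s) e)" if "e \<in> arcs G" for e
    unfolding continuous_on_def
  proof
    fix t assume t: "t \<in> {0..k}"
    show "((\<lambda>s. drift (\<sigma> s) e) \<longlongrightarrow> drift (\<sigma> t) e) (at t within {0..k})"
    proof (rule drift_tendsto)
      show "\<forall>\<^sub>F s in at t within {0..k}. \<sigma> s \<in> density_space G B"
        using \<sigma>_in \<epsilon> by (auto simp: eventually_at_filter)
    qed (use cont \<sigma>_in t \<epsilon> that in \<open>auto simp: continuous_on_def\<close>)
  qed
  have left: "((\<lambda>s. \<sigma> s e) has_real_derivative drift (\<sigma> t) e) (at t within {0..k})"
    if t: "t \<in> {0..k}" and e: "e \<in> arcs G" for t e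
  proof (cases "t = k")
    case True
    have "((\<lambda>s. \<sigma> s e) has_real_derivative drift (\<sigma> k) e) (at k within {0..k})"
      using k cont[OF e] drift_cont[OF e]
    proof (rule has_real_derivative_at_right_end)
      fix s assume "0 < s" "s < k"
      then show "((\<lambda>s. \<sigma> s e) has_real_derivative drift (\<sigma> s) e) (at s)"
        using inner[of s e] e by (simp add: at_within_Icc_at)
    qed
    with True show ?thesis by simp
  qed (use inner that in auto)
  have right: "((\<lambda>s. \<sigma> s e) has_real_derivative drift (\<sigma> t) e) (at t within {k..k + \<epsilon>})"
    if t: "t \<in> {k..k + \<epsilon>}" and e: "e \<in> arcs G" for t e
  proof -
    have img: "(+) k ` {0..\<epsilon>} = {k..k + \<epsilon>}" by simp
    have "((\<lambda>s. q s e) has_real_derivative drift (q (t - k)) e) (at (t - k) within {0..\<epsilon>})"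
      using q t e by (auto simp: solution_on_iff)
    then have "((\<lambda>s. \<sigma> (k + s) e) has_real_derivative drift (\<sigma> t) e) (at (t - k) within {0..\<epsilon>})"
      by (rule has_field_derivative_transform_within[OF _ zero_less_one, THEN DERIV_cong])
         (use t in \<open>auto simp: \<sigma>_right\<close>)
    then show ?thesis
      using DERIV_at_within_shift[of "\<lambda>s. \<sigma> s e" "drift (\<sigma> t) e" k "t - k" "{0..\<epsilon>}"] img by (simp add: add.commute)
  qed
  have union: "{0..k} \<union> {k..k + \<epsilon>} = {0..k + \<epsilon>}" using k \<epsilon> by auto
  have "((\<lambda>s. \<sigma> s e) has_real_derivative drift (\<sigma> t) e) (at t within {0..k + \<epsilon>})"
    if "t \<in> {0..k + \<epsilon>}" "e \<in> arcs G" for t e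
    using has_real_derivative_within_Un[of "{0..k}" "{k..k + \<epsilon>}" t "\<lambda>s. \<sigma> s e" "drift (\<sigma> t) e"]
      left[of t e] right[of t e] that unfolding union by auto
  moreover have "\<sigma> 0 = \<rho>0" using sol k by (auto simp: \<sigma>_left solution_on_iff)
  ultimately have "solution_on G lam B f \<rho>0 {0..k + \<epsilon>} \<sigma>"
    using \<sigma>_in by (auto simp: solution_on_iff)
  then show ?thesis using \<epsilon> by (intro exI[of _ "k + \<epsilon>"]) auto
qed

text \<open>
  The outflow of a link is at most its capacity, so adding \<open>cap e * t\<close> to the density gives a
  nondecreasing bounded function of time.
\<close>

lemma solution_limit:
  assumes k: "0 < k" and sol: "solution_on G lam B f \<rho>0 {0..<k} \<rho>"
  shows "\<exists>x\<in>closed_box. x \<in> extensional (arcs G) \<and>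
    (\<forall>e\<in>arcs G. ((\<lambda>t. \<rho> t e) \<longlongrightarrow> x e) (at_left k))"
proof -
  have in_space: "\<rho> t \<in> density_space G B" if "t \<in> {0..<k}" for t
    using sol that by (auto simp: solution_on_iff)
  have "\<exists>l. ((\<lambda>t. \<rho> t e) \<longlongrightarrow> l) (at_left k) \<and> 0 \<le> l \<and> l \<le> B e" if e: "e \<in> arcs G" for e
  proof -
    have box: "0 \<le> \<rho> t e" "\<rho> t e \<le> B e" if "t \<in> {0..<k}" for t
      using density_space_closed_box[OF in_space[OF that]] e by (auto simp: closed_box_def)
    define w where "w t = \<rho> t e + cap e * t" for t
    have deriv: "(w has_real_derivative drift (\<rho> t) e + cap e) (at t within {0..<k})" if "t \<in> {0..<k}" for t
      unfolding w_def using sol that e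
      by (auto intro!: derivative_eq_intros simp: solution_on_iff)
    have up: "0 \<le> drift (\<rho> t) e + cap e" if "t \<in> {0..<k}" for t
    proof -
      have "outflow (\<rho> t) e \<le> cap e" by (intro outflow_le_cap loc_Link_density e in_space that)
      moreover have "0 \<le> inflow (\<rho> t) e"
        by (intro inflow_nonneg e loc_in_space_density policy_links_upstream in_space that)
      ultimately show ?thesis by (simp add: drift_def)
    qed
    have cap: "0 \<le> cap e"
      using outflow_le_cap[OF e loc_Link_density[OF e in_space]] outflow_nonneg[OF e loc_Link_density[OF e in_space]] k
      by (meson atLeastLessThan_iff order_refl order_trans)
    have mono: "w a \<le> w b" if "a \<in> {0..<k}" "b \<in> {0..<k}" "a \<le> b" for a b
    proof (rule DERIV_nonneg_imp_increasing_open[OF that(3)])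
      show "continuous_on {a..b} w"
        using DERIV_continuous_on[OF deriv] by (rule continuous_on_subset) (use that in auto)
      fix t assume t: "a < t" "t < b"
      have "at t within {0..<k} = at t"
        by (rule at_within_interior) (use t that in auto)
      then show "\<exists>y. (w has_real_derivative y) (at t) \<and> 0 \<le> y"
        using deriv[of t] up[of t] t that by auto
    qed
    have "(w \<longlongrightarrow> Sup (w ` ({..<k} \<inter> {0..<k}))) (at k within ({..<k} \<inter> {0..<k}))"
    proof (rule Lim_left_bound[where K = "B e + cap e * k"])
      fix b assume b: "b \<in> {0..<k}" "b < k"
      then have "cap e * b \<le> cap e * k" using cap by (intro mult_left_mono) auto
      then show "w b \<le> B e + cap e * k" using box[OF b(1)] by (simp add: w_def)
    qed (use mono in auto)
    moreover have "at k within ({..<k} \<inter> {0..<k}) = at_left k"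
      by (rule at_within_nhd[of _ "{0<..}"]) (use k in auto)
    ultimately obtain l where "(w \<longlongrightarrow> l) (at_left k)" by auto
    then have "((\<lambda>t. w t - cap e * t) \<longlongrightarrow> l - cap e * k) (at_left k)" by (intro tendsto_intros)
    then have lim: "((\<lambda>t. \<rho> t e) \<longlongrightarrow> l - cap e * k) (at_left k)" by (simp add: w_def)
    have ev: "\<forall>\<^sub>F t in at_left k. t \<in> {0..<k}"
      using eventually_at_left_real[OF k] by eventually_elim auto
    have "0 \<le> l - cap e * k" "l - cap e * k \<le> B e"
      by (rule tendsto_lowerbound[OF lim] tendsto_upperbound[OF lim], rule eventually_mono[OF ev], use box in auto)+
    with lim show ?thesis by blast
  qed
  then obtain x where x: "\<And>e. e \<in> arcs G \<Longrightarrow> ((\<lambda>t. \<rho> t e) \<longlongrightarrow> x e) (at_left k) \<and> 0 \<le> x e \<and> x e \<le> B e"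
    by metis
  show ?thesis
    by (rule bexI[of _ "restrict x (arcs G)"]) (use x in \<open>auto simp: closed_box_def\<close>)
qed

section \<open>Saturation at the end of the lifetime\<close>

text \<open>
  Moving one coordinate, that of a link which is full in the limit, to its buffer capacity changes
  the flows by at most a multiple of the space left on that link. The last assumption keeps the
  local densities away from the point where everything is full.
\<close>

lemma flow_near_full:
  assumes lip: "\<forall>a\<in>policy_links G lam. loc a x \<in> local_space G B a \<longrightarrow> flow_lipschitz m x a"
    and m: "0 < m" and x: "x \<in> closed_box" and y: "y \<in> density_space G B"
    and near: "near m x y"
    and a: "a \<in> policy_links G lam" and e: "e \<in> arcs G" "x e = B e"
    and slack: "a \<in> Link ` dest_links G \<or> (\<exists>k\<in>local_links G a. x k \<noteq> B k)"
  shows "loc a (y(e := B e)) \<in> local_space G B a"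
    and "j \<in> downstream G a \<Longrightarrow>
      \<bar>f a (loc a y) j - f a (loc a (y(e := B e))) j\<bar> \<le> m * (B e - y e)"
proof -
  have sub: "local_links G a \<subseteq> arcs G" by (rule local_links_subset[OF a])
  have y_box: "0 \<le> y k" "y k < B k" if "k \<in> arcs G" for k
    using y that by (auto simp: density_space_def PiE_iff)
  have loc_x: "loc a x \<in> local_space G B a"
  proof (rule loc_in_space[OF a x])
    have "x k < B k" if "k \<in> local_links G a" "x k \<noteq> B k" for k
      using that sub x by (force simp: closed_box_def)
    with slack show "a \<in> Link ` dest_links G \<or> (\<exists>k\<in>local_links G a. x k < B k)" by blast
  qed
  show loc_z: "loc a (y(e := B e)) \<in> local_space G B a"
  proof (rule loc_in_space[OF a])
    show "y(e := B e) \<in> closed_box"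
      using y_box B_pos by (auto simp: closed_box_def less_imp_le)
    have "(y(e := B e)) k < B k" if "k \<in> local_links G a" "x k \<noteq> B k" for k
      using that sub e(2) y_box[of k] by auto
    with slack show "a \<in> Link ` dest_links G \<or> (\<exists>k\<in>local_links G a. (y(e := B e)) k < B k)"
      by blast
  qed
  assume j: "j \<in> downstream G a"
  have "\<bar>f a (loc a y) j - f a (loc a (y(e := B e))) j\<bar>
      \<le> m * (\<Sum>k\<in>arcs G. \<bar>y k - (y(e := B e)) k\<bar>)"
  proof -
    have "near m x (y(e := B e))" using near e m by (simp add: near_def)
    with lip a loc_x loc_z loc_in_space_density[OF a y] near j
    show ?thesis unfolding flow_lipschitz_def by blast
  qed
  also have "(\<Sum>k\<in>arcs G. \<bar>y k - (y(e := B e)) k\<bar>) = (\<Sum>k\<in>arcs G. if k = e then B e - y e else 0)"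
    using y_box[OF e(1)] by (intro sum.cong) auto
  also have "\<dots> = B e - y e" using e by simp
  finally show "\<bar>f a (loc a y) j - f a (loc a (y(e := B e))) j\<bar> \<le> m * (B e - y e)" .
qed

text \<open>
  The nodes all of whose outgoing links are full in the limit form the required set. The inequality
  between its inflow and its capacity is forced by the barrier argument, applied to the space left
  on all full links, including those (the set \<open>P\<close> below) that do not start in \<open>S\<close>.
\<close>

lemma saturated_cut:
  assumes k: "0 < k" and sol: "solution_on G lam B f \<rho>0 {0..<k} \<rho>" and x: "x \<in> closed_box"
    and lim: "\<And>e. e \<in> arcs G \<Longrightarrow> ((\<lambda>t. \<rho> t e) \<longlongrightarrow> x e) (at_left k)"
    and full: "\<exists>e\<in>arcs G. x e = B e"
  shows "\<exists>S\<subseteq>verts G - dests G. (\<forall>e\<in>out_links G S. x e = B e) \<and>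
    (\<Sum>e\<in>out_boundary G S. cap e) < cut_inflow lam S"
proof -
  define F where "F = {e \<in> arcs G. x e = B e}"
  define S where "S = {v \<in> verts G - dests G. out_arcs G v \<subseteq> F}"
  define P where "P = {e \<in> F. tail G e \<notin> S}"
  have S_sub: "S \<subseteq> verts G - dests G" by (auto simp: S_def)
  have F_sub: "F \<subseteq> arcs G" by (auto simp: F_def)
  have fin: "finite F" using finite_subset[OF F_sub] by simp
  have F_split: "F = out_links G S \<union> P" "out_links G S \<inter> P = {}"
    by (auto simp: P_def out_links_def S_def F_def)
  obtain m where m: "0 < m"
    and lip: "\<forall>a\<in>policy_links G lam. loc a x \<in> local_space G B a \<longrightarrow> flow_lipschitz m x a"
    using flows_lipschitz[of x] by blast
  define nd where "nd e = real (card (downstream G (Link e :: ('v, 'e) alink)))" for e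
  define nu where "nu e = real (card (upstream G lam e))" for e
  define M where "M = ((\<Sum>e\<in>arcs G. nd e) + (\<Sum>e\<in>arcs G. nd e) + (\<Sum>e\<in>arcs G. nu e)) * m"
  have drift_bound: "(\<Sum>e\<in>F. drift y e) \<le> cut_inflow lam S - (\<Sum>e\<in>out_boundary G S. cap e)
      + M * (\<Sum>e\<in>F. B e - y e)"
    if y: "y \<in> density_space G B" and near: "near m x y" for y
  proof -
    define gap where "gap = (\<Sum>e\<in>F. B e - y e)"
    have y_box: "0 \<le> y e" "y e < B e" if "e \<in> arcs G" for e
      using y that by (auto simp: density_space_def PiE_iff)
    have gap: "m * (B e - y e) \<le> m * gap" if "e \<in> F" for e
      unfolding gap_def using m fin that F_sub y_box
      by (intro mult_left_mono member_le_sum) (auto intro: less_imp_le)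
    have gap0: "0 \<le> m * gap"
      unfolding gap_def using m F_sub y_box by (intro mult_nonneg_nonneg sum_nonneg) (auto intro: less_imp_le)
    note near_full = flow_near_full[OF lip m x y near]
    \<comment> \<open>A full link receives almost nothing from a link that sees some space elsewhere.\<close>
    have vanish: "f a (loc a y) (Link e) \<le> m * gap"
      if a: "a \<in> policy_links G lam" "a \<notin> Link ` dest_links G" and e: "e \<in> F"
        and down: "Link e \<in> downstream G a" "e \<in> local_links G a"
        and slack: "k \<in> local_links G a" "k \<notin> F" for a e k
    proof -
      have slack': "\<exists>k\<in>local_links G a. x k \<noteq> B k"
        using slack local_links_subset[OF a(1)] by (auto simp: F_def)
      have eB: "e \<in> arcs G" "x e = B e" using e by (auto simp: F_def)
      have "f a (loc a (y(e := B e))) (Link e) = 0"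
        using near_full(1)[OF a(1) eB] slack' a down by (intro flow_full) auto
      then show ?thesis using near_full(2)[OF a(1) eB _ down(1)] slack' gap[OF e] by auto
    qed
    \<comment> \<open>The start of such a link is not in \<open>S\<close>, so it has an outgoing link with space left.\<close>
    have in_bound: "inflow y e \<le> nu e * (m * gap)" if "e \<in> P" for e
    proof -
      have e: "e \<in> F" "e \<in> arcs G" "tail G e \<notin> S" using that F_sub by (auto simp: P_def)
      then obtain k where k: "k \<in> out_arcs G (tail G e)" "k \<notin> F"
        using tail_not_dest[of e] unfolding S_def by blast
      have "inflow y e \<le> (\<Sum>a\<in>upstream G lam e. m * gap)"
        unfolding inflow_def
      proof (intro sum_mono)
        fix a assume a: "a \<in> upstream G lam e"
        show "f a (loc a y) (Link e) \<le> m * gap"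
          using policy_links_upstream[OF a] upstream_not_dest[OF e(2) a] e(1)
        proof (rule vanish)
          show "Link e \<in> downstream G a" using downstream_upstream[OF e(2) a] e(2) by auto
          show "e \<in> local_links G a" using local_links_upstream[OF a] e(2) by auto
          show "k \<in> local_links G a" using local_links_upstream[OF a] k by blast
        qed (rule k)
      qed
      then show ?thesis by (simp add: nu_def)
    qed
    \<comment> \<open>Such a link has space left itself, while everything ahead of it is full.\<close>
    have stuck_bound: "outflow y e \<le> nd e * (m * gap)"
      if e: "e \<in> arcs G" "e \<notin> F" "head G e \<in> S" for e
    proof -
      have nd: "e \<notin> dest_links G" using e S_sub by (auto simp: dest_links_iff)
      have "outflow y e \<le> (\<Sum>j\<in>downstream G (Link e :: ('v, 'e) alink). m * gap)"
        unfolding outflow_def f_out_def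
      proof (intro sum_mono)
        fix j :: "('v, 'e) alink" assume j: "j \<in> downstream G (Link e)"
        with nd obtain k where k: "j = Link k" "k \<in> out_arcs G (head G e)" by auto
        then have "k \<in> F" using e(3) unfolding S_def by blast
        then show "f (Link e) (loc (Link e) y) j \<le> m * gap"
          unfolding k(1) using e nd k by (intro vanish[of _ _ e]) auto
      qed
      then show ?thesis by (simp add: nd_def)
    qed
    \<comment> \<open>A link leaving \<open>S\<close> is full and sees free space ahead, so it is drained at almost full rate.\<close>
    have drain_bound: "cap e - outflow y e \<le> nd e * (m * gap)" if b: "e \<in> out_boundary G S" for e
    proof -
      have e: "e \<in> arcs G" "tail G e \<in> S" "head G e \<notin> S" using b by (auto simp: out_boundary_def)
      have eF: "e \<in> F" using e by (auto simp: S_def)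
      then have eB: "x e = B e" by (auto simp: F_def)
      have slack: "Link e \<in> Link ` dest_links G \<or> (\<exists>k\<in>local_links G (Link e). x k \<noteq> B k)"
      proof (cases "head G e \<in> dests G")
        case False
        with e obtain k where "k \<in> out_arcs G (head G e)" "k \<notin> F"
          using head_in_verts[OF e(1)] unfolding S_def by blast
        then show ?thesis by (auto simp: F_def)
      qed (use e in \<open>auto simp: dest_links_iff\<close>)
      have "outflow (y(e := B e)) e = cap e"
        using near_full(1)[OF Link_policy[OF e(1)] e(1) eB slack] e(1) by (intro outflow_full) auto
      then have "cap e - outflow y e = (\<Sum>j\<in>downstream G (Link e).
          f (Link e) (loc (Link e) (y(e := B e))) j - f (Link e) (loc (Link e) y) j)"
        by (simp add: outflow_def f_out_def sum_subtractf)
      also have "\<dots> \<le> (\<Sum>j\<in>downstream G (Link e :: ('v, 'e) alink). m * gap)"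
      proof (intro sum_mono)
        fix j assume "j \<in> downstream G (Link e)"
        from near_full(2)[OF Link_policy[OF e(1)] e(1) eB slack this] gap[OF eF]
        show "f (Link e) (loc (Link e) (y(e := B e))) j - f (Link e) (loc (Link e) y) j \<le> m * gap"
          by linarith
      qed
      finally show ?thesis by (simp add: nd_def)
    qed
    have nonneg: "0 \<le> nd e" "0 \<le> nu e" for e by (auto simp: nd_def nu_def)
    have total: "(\<Sum>e\<in>X. n e * (m * gap)) \<le> (\<Sum>e\<in>arcs G. n e) * (m * gap)"
      if "X \<subseteq> arcs G" "\<And>e. 0 \<le> n e" for X and n :: "'e \<Rightarrow> real"
      unfolding sum_distrib_right using that gap0 by (intro sum_mono2) auto
    define Ent where "Ent = {e \<in> arcs G. tail G e \<notin> S \<and> head G e \<in> S}"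
    have out0: "0 \<le> outflow y e" if "e \<in> arcs G" for e
      by (intro outflow_nonneg loc_Link_density that y)
    have P_sub: "P \<subseteq> arcs G" using F_sub by (auto simp: P_def)
    have finP: "finite P" using P_sub by (rule finite_subset) simp
    have "(\<Sum>e\<in>P. inflow y e) \<le> (\<Sum>e\<in>P. nu e * (m * gap))"
      by (intro sum_mono in_bound)
    also have "\<dots> \<le> (\<Sum>e\<in>arcs G. nu e) * (m * gap)" by (rule total[OF P_sub nonneg(2)])
    finally have "(\<Sum>e\<in>P. inflow y e) \<le> (\<Sum>e\<in>arcs G. nu e) * (m * gap)" .
    moreover have "(\<Sum>e\<in>Ent. outflow y e) \<le> (\<Sum>e\<in>arcs G. nd e) * (m * gap) + (\<Sum>e\<in>P. outflow y e)"
    proof -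
      have "(\<Sum>e\<in>Ent. outflow y e) = (\<Sum>e\<in>Ent - F. outflow y e) + (\<Sum>e\<in>Ent \<inter> F. outflow y e)"
        by (subst sum.union_disjoint[symmetric]) (auto simp: Ent_def intro!: sum.cong)
      moreover have "(\<Sum>e\<in>Ent - F. outflow y e) \<le> (\<Sum>e\<in>Ent - F. nd e * (m * gap))"
        by (intro sum_mono stuck_bound) (auto simp: Ent_def)
      moreover have "(\<Sum>e\<in>Ent - F. nd e * (m * gap)) \<le> (\<Sum>e\<in>arcs G. nd e) * (m * gap)"
        by (rule total[OF _ nonneg(1)]) (auto simp: Ent_def)
      \<comment> \<open>The full links entering \<open>S\<close> belong to \<open>P\<close>: their outflow is paid for by their own loss.\<close>
      moreover have "(\<Sum>e\<in>Ent \<inter> F. outflow y e) \<le> (\<Sum>e\<in>P. outflow y e)"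
        by (rule sum_mono2[OF finP]) (use out0 P_sub in \<open>auto simp: Ent_def P_def\<close>)
      ultimately show ?thesis by linarith
    qed
    moreover have "(\<Sum>e\<in>out_boundary G S. cap e) - (\<Sum>e\<in>out_boundary G S. outflow y e)
        \<le> (\<Sum>e\<in>arcs G. nd e) * (m * gap)"
    proof -
      have "(\<Sum>e\<in>out_boundary G S. cap e - outflow y e) \<le> (\<Sum>e\<in>out_boundary G S. nd e * (m * gap))"
        by (intro sum_mono drain_bound)
      also have "\<dots> \<le> (\<Sum>e\<in>arcs G. nd e) * (m * gap)"
        by (rule total[OF out_boundary_subset nonneg(1)])
      finally show ?thesis by (simp add: sum_subtractf)
    qed
    moreover have "(\<Sum>e\<in>F. drift y e) = (\<Sum>e\<in>out_links G S. drift y e)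
        + ((\<Sum>e\<in>P. inflow y e) - (\<Sum>e\<in>P. outflow y e))"
      using F_split fin by (simp add: sum.union_disjoint drift_def sum_subtractf)
    moreover note cut_balance[OF S_sub y, folded Ent_def]
    ultimately show ?thesis by (simp add: M_def gap_def algebra_simps)
  qed
  have "(\<Sum>e\<in>out_boundary G S. cap e) < cut_inflow lam S"
  proof (rule ccontr)
    assume not: "\<not> ?thesis"
    have "\<forall>\<^sub>F t in at_left k. \<forall>e\<in>arcs G. dist (\<rho> t e) (x e) < 1 / m"
      using m by (intro eventually_ball_finite ballI tendstoD[OF lim]) auto
    then obtain b where b: "b < k" "\<And>t e. b < t \<Longrightarrow> t < k \<Longrightarrow> e \<in> arcs G \<Longrightarrow> dist (\<rho> t e) (x e) < 1 / m"
      unfolding eventually_at_left[OF k] by blast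
    \<comment> \<open>Positive, so that derivatives at later times are two-sided.\<close>
    define t0 where "t0 = max ((b + k) / 2) (k / 2)"
    have t0: "0 < t0" "b < t0" "t0 < k" using b(1) k by (auto simp: t0_def less_max_iff_disj)
    have in_space: "\<rho> t \<in> density_space G B" if "t0 \<le> t" "t < k" for t
      using sol that t0 by (auto simp: solution_on_iff)
    have "\<not> ((\<lambda>t. \<Sum>e\<in>F. B e - \<rho> t e) \<longlongrightarrow> 0) (at_left k)"
    proof (rule exponential_barrier[OF t0(3)])
      fix t assume t: "t0 \<le> t" "t < k"
      have interior: "at t within {0..<k} = at t"
        by (rule at_within_interior) (use t t0 in auto)
      have "((\<lambda>s. \<rho> s e) has_real_derivative drift (\<rho> t) e) (at t within {0..<k})" if "e \<in> F" for e
        using sol t t0 that F_sub by (auto simp: solution_on_iff)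
      then have "((\<lambda>s. \<rho> s e) has_real_derivative drift (\<rho> t) e) (at t)" if "e \<in> F" for e
        using that unfolding interior .
      then show "((\<lambda>s. \<Sum>e\<in>F. B e - \<rho> s e) has_real_derivative (\<Sum>e\<in>F. 0 - drift (\<rho> t) e)) (at t)"
        by (intro DERIV_sum DERIV_diff DERIV_const)
      have "near m x (\<rho> t)" using b(2)[of t] t t0 by (auto simp: near_def dist_real_def)
      from drift_bound[OF in_space[OF t] this] not
      show "- M * (\<Sum>e\<in>F. B e - \<rho> t e) \<le> (\<Sum>e\<in>F. 0 - drift (\<rho> t) e)"
        by (simp add: sum_negf)
    next
      show "0 < (\<Sum>e\<in>F. B e - \<rho> t0 e)"
        using in_space[of t0] t0 F_sub fin full
        by (intro sum_pos) (auto simp: F_def density_space_def PiE_iff)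
    qed
    moreover have "((\<lambda>t. \<Sum>e\<in>F. B e - \<rho> t e) \<longlongrightarrow> (\<Sum>e\<in>F. B e - x e)) (at_left k)"
      using F_sub by (intro tendsto_intros lim) auto
    moreover have "(\<Sum>e\<in>F. B e - x e) = 0" by (simp add: F_def)
    ultimately show False by simp
  qed
  moreover have "x e = B e" if "e \<in> out_links G S" for e
    using that F_split by (auto simp: F_def)
  ultimately show ?thesis using S_sub by blast
qed

end

text \<open>
  Destinations can only be reached from the additional node through a source link, so there is an
  origin, and an origin alone is a cut. Without any cut, the maximum over all cuts would be a default
  value.
\<close>

lemma connectivity_cuts_nonempty:
  assumes "connectivity G lam"
  shows "cuts G \<noteq> {}"
proof -
  obtain d where d: "d \<in> dests G" using assms by (auto simp: connectivity_def)
  have "None \<in> verts (augmented G lam)" "Some d \<in> verts (augmented G lam)"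
    using d by (auto simp: augmented_def dests_def)
  then have "(None, Some d) \<in> rtrancl_on (verts (augmented G lam)) (arcs_ends (augmented G lam))"
    using assms by (auto simp: connectivity_def strongly_connected_def reachable_def)
  moreover have "w = None"
    if "(None, w) \<in> rtrancl_on (verts (augmented G lam)) (arcs_ends (augmented G lam))"
      and "origins G lam = {}" for w
    using that(1)
  proof (induction rule: rtrancl_on_induct)
    case (step y z)
    then show ?case using that(2) by (auto simp: arcs_ends_def arc_to_ends_def augmented_def)
  qed simp
  ultimately obtain v where "v \<in> origins G lam" by blast
  then have "{v} \<in> cuts G" by (auto simp: cuts_def origins_def)
  then show ?thesis by blast
qed

theorem proposition1:
  fixes G :: "('v, 'e) pre_digraph"
    and C :: "'e \<Rightarrow> ereal"
    and lam :: "'v \<Rightarrow> real"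
    and B :: "'e \<Rightarrow> real"
    and f :: "('v, 'e) flow_family"
  assumes "flow_network G C lam"
    and "connectivity G lam"
    and "\<And>e. e \<in> arcs G \<Longrightarrow> 0 < B e"
    and "routing_policy G C lam B f"
    and "monotone_policy G lam B f"
    and "Max ((\<lambda>U. ereal (cut_inflow lam U) - cut_capacity G C U) ` cuts G) > 0"
  shows "\<forall>\<rho>0\<in>density_space G B.
    lifetime G lam B f \<rho>0 \<le>
      Min ((\<lambda>U. ereal (\<Sum>e\<in>out_links G U. B e - \<rho>0 e) /
                 (ereal (cut_inflow lam U) - cut_capacity G C U)) `
           {U \<in> cuts G. ereal (cut_inflow lam U) > cut_capacity G C U}) \<and>
    (\<forall>\<rho>. solution_on G lam B f \<rho>0 {t. 0 \<le> t \<and> ereal t < lifetime G lam B f \<rho>0} \<rho> \<longrightarrow>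
      (\<exists>S\<in>cuts G. ereal (cut_inflow lam S) > cut_capacity G C S \<and>
        (\<forall>e\<in>arcs G. \<forall>t. 0 \<le> t \<and> ereal t < lifetime G lam B f \<rho>0 \<longrightarrow> \<rho> t e < B e) \<and>
        (\<forall>e\<in>out_links G S.
           ((\<lambda>t. \<rho> t e) \<longlongrightarrow> B e) (at_left (real_of_ereal (lifetime G lam B f \<rho>0))))))"
proof (intro ballI)
  fix \<rho>0 assume \<rho>0: "\<rho>0 \<in> density_space G B"
  interpret buffered_network G C lam B f
    using assms by unfold_locales
  define Over where "Over = {U \<in> cuts G. ereal (cut_inflow lam U) > cut_capacity G C U}"
  define bound where "bound U = (\<Sum>e\<in>out_links G U. B e - \<rho>0 e)
      / (cut_inflow lam U - (\<Sum>e\<in>out_boundary G U. cap e))" for U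
  let ?\<kappa> = "lifetime G lam B f \<rho>0"
  have fin: "finite (cuts G)" by (simp add: cuts_def)
  have Over_iff: "U \<in> Over \<longleftrightarrow> U \<in> cuts G \<and> (\<Sum>e\<in>out_boundary G U. cap e) < cut_inflow lam U" for U
    by (auto simp: Over_def cut_capacity_eq)
  have "Over \<noteq> {}"
  proof -
    have "\<exists>U\<in>cuts G. 0 < ereal (cut_inflow lam U) - cut_capacity G C U"
      using assms(6) fin connectivity_cuts_nonempty[OF assms(2)] by (subst (asm) Max_gr_iff) auto
    then show ?thesis by (auto simp: cut_capacity_eq Over_def)
  qed
  have le_bound: "?\<kappa> \<le> ereal (bound U)" if U: "U \<in> Over" for U
    unfolding lifetime_def
  proof (rule Sup_least, clarify)
    fix t \<rho> assume "0 \<le> t" "solution_on G lam B f \<rho>0 {0..t} \<rho>"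
    with U show "ereal t \<le> ereal (bound U)"
      using solution_time_bound[of U \<rho>0 t \<rho>] by (auto simp: Over_iff bound_def field_simps)
  qed
  have ereal_bound: "ereal (\<Sum>e\<in>out_links G U. B e - \<rho>0 e)
      / (ereal (cut_inflow lam U) - cut_capacity G C U) = ereal (bound U)" if "U \<in> Over" for U
    using that by (simp add: cut_capacity_eq bound_def Over_iff)
  have first: "?\<kappa> \<le> Min ((\<lambda>U. ereal (\<Sum>e\<in>out_links G U. B e - \<rho>0 e) /
      (ereal (cut_inflow lam U) - cut_capacity G C U)) ` Over)"
    using fin \<open>Over \<noteq> {}\<close> le_bound ereal_bound by (subst Min_ge_iff) (auto simp: Over_def)
  have live: "ereal t \<le> ?\<kappa>" if "0 \<le> t" "solution_on G lam B f \<rho>0 {0..t} \<rho>" for t \<rho>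
    unfolding lifetime_def by (rule Sup_upper) (use that in blast)
  obtain \<epsilon> \<rho>' where "0 < \<epsilon>" "solution_on G lam B f \<rho>0 {0..\<epsilon>} \<rho>'" using local_solution[OF \<rho>0] .
  then have pos: "ereal \<epsilon> \<le> ?\<kappa>" "0 < \<epsilon>" using live by auto
  obtain U where "U \<in> Over" using \<open>Over \<noteq> {}\<close> by blast
  obtain k where \<kappa>: "?\<kappa> = ereal k" using pos le_bound[OF \<open>U \<in> Over\<close>] by (cases ?\<kappa>) auto
  have k: "0 < k" using pos by (simp add: \<kappa>)
  have T: "{t. 0 \<le> t \<and> ereal t < ?\<kappa>} = {0..<k}" by (auto simp: \<kappa>)
  have second: "\<exists>S\<in>cuts G. ereal (cut_inflow lam S) > cut_capacity G C S \<and>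
      (\<forall>e\<in>arcs G. \<forall>t. 0 \<le> t \<and> ereal t < ?\<kappa> \<longrightarrow> \<rho> t e < B e) \<and>
      (\<forall>e\<in>out_links G S. ((\<lambda>t. \<rho> t e) \<longlongrightarrow> B e) (at_left (real_of_ereal ?\<kappa>)))"
    if sol: "solution_on G lam B f \<rho>0 {0..<k} \<rho>" for \<rho>
  proof -
    obtain x where x: "x \<in> closed_box" "x \<in> extensional (arcs G)"
      and lim: "\<And>e. e \<in> arcs G \<Longrightarrow> ((\<lambda>t. \<rho> t e) \<longlongrightarrow> x e) (at_left k)"
      using solution_limit[OF k sol] by blast
    have "\<exists>e\<in>arcs G. x e = B e"
    proof (rule ccontr)
      assume "\<not> ?thesis"
      then have "x \<in> density_space G B"
        using x by (fastforce simp: density_space_def closed_box_def PiE_iff)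
      from solution_extends[OF k sol this lim] obtain t \<sigma>
        where "k < t" "solution_on G lam B f \<rho>0 {0..t} \<sigma>" by blast
      then show False using live[of t \<sigma>] k by (simp add: \<kappa>)
    qed
    then obtain S where S: "S \<subseteq> verts G - dests G" "\<forall>e\<in>out_links G S. x e = B e"
      "(\<Sum>e\<in>out_boundary G S. cap e) < cut_inflow lam S"
      using saturated_cut[OF k sol x(1) lim] by blast
    show ?thesis
    proof (intro bexI conjI ballI allI impI)
      show "S \<in> cuts G" using S by (auto simp: cuts_def cut_inflow_def out_boundary_def)
      show "cut_capacity G C S < ereal (cut_inflow lam S)" using S(3) by (simp add: cut_capacity_eq)
      show "\<rho> t e < B e" if "e \<in> arcs G" "0 \<le> t \<and> ereal t < ?\<kappa>" for e t
        using sol that by (auto simp: \<kappa> solution_on_iff density_space_def PiE_iff)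
      show "((\<lambda>t. \<rho> t e) \<longlongrightarrow> B e) (at_left (real_of_ereal ?\<kappa>))" if "e \<in> out_links G S" for e
        using lim[of e] bspec[OF S(2) that] that by (auto simp: \<kappa> out_links_def)
    qed
  qed
  show "?\<kappa> \<le> Min ((\<lambda>U. ereal (\<Sum>e\<in>out_links G U. B e - \<rho>0 e) /
                 (ereal (cut_inflow lam U) - cut_capacity G C U)) `
           {U \<in> cuts G. ereal (cut_inflow lam U) > cut_capacity G C U}) \<and>
    (\<forall>\<rho>. solution_on G lam B f \<rho>0 {t. 0 \<le> t \<and> ereal t < ?\<kappa>} \<rho> \<longrightarrow>
      (\<exists>S\<in>cuts G. ereal (cut_inflow lam S) > cut_capacity G C S \<and>
        (\<forall>e\<in>arcs G. \<forall>t. 0 \<le> t \<and> ereal t < ?\<kappa> \<longrightarrow> \<rho> t e < B e) \<and>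
        (\<forall>e\<in>out_links G S. ((\<lambda>t. \<rho> t e) \<longlongrightarrow> B e) (at_left (real_of_ereal ?\<kappa>)))))"
    using first second unfolding T Over_def by blast
qed

end
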